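(* Let $e=2$ and let $\Lambda=a_0\Lambda_0+a_1\Lambda_1$ be a dominant integral weight of $A^{(1)}_1$ with $r=a_0+a_1>1$. For any positive integer $d$, set \[ m_0=-\left\lceil\frac{d+a_0}{2}\right\rceil,\qquad m_1=\left\lceil\frac{d+a_1}{2}\right\rceil, \] and \[ N'(d)=\max\big(2s(m_0)+m_0,\;2s(m_1)+m_1\big). \] Then every weight $\eta\in P(\Lambda)$ of defect $d$ with $\deg(\eta)\ge N'(d)$ is external (that is, $i$-external for both $i=0$ and $i=1$).
   Context: Let $\mathfrak g=A^{(1)}_1$ be the affine Lie algebra with fundamental weights $\Lambda_0,\Lambda_1$, null root $\delta=\alpha_0+\alpha_1$ and simple roots $\alpha_0=2\Lambda_0-2\Lambda_1+\delta$, $\alpha_1=-2\Lambda_0+2\Lambda_1$. Let $(\cdot\mid\cdot)$ be the standard symmetric form, so $(\lambda\mid\alpha_i)=\langle\lambda,\alpha_i^\vee\rangle$, $(\alpha_i\mid\alpha_i)=2$, $(\alpha_0\mid\alpha_1)=-2$. Let $V(\Lambda)$ be the irreducible highest weight module with highest weight $\Lambda$, $P(\Lambda)$ its set of weights, $\max(\Lambda)=\{\lambda\in P(\Lambda)\mid\lambda+\delta\notin P(\Lambda)\}$, and $B(\Lambda)$ the Kashiwara crystal of $V(\Lambda)$ with crystal operators $\tilde e_i,\tilde f_i$. Every $\lambda\in P(\Lambda)$ has the form $\Lambda-\alpha$ with $\alpha=c_0\alpha_0+c_1\alpha_1$, $c_0,c_1\in\mathbb Z_{\ge0}$. Its degree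 is $\deg(\lambda)=c_0+c_1$; its hub is $[\theta_0,\theta_1]$ with $\theta_i=\langle\lambda,\alpha_i^\vee\rangle$; its defect is $\tfrac12\big((\Lambda\mid\Lambda)-(\lambda\mid\lambda)\big)=(\Lambda\mid\alpha)-\tfrac12(\alpha\mid\alpha)$. For $m\in\mathbb Z$, $s(m)$ denotes the unique integer such that $\Lambda-m\alpha_1-s(m)\delta\in\max(\Lambda)$. Explicitly, with $b_0=\lfloor a_0/2\rfloor$ and $m=qr+u$, $q\in\mathbb Z$, $-b_0\le u\le r-b_0-1$, one has $s(m)=\max(-u,0,u-a_1)-q(a_1-2u)+q^2r$. An element $b\in B(\Lambda)$ whose weight has hub $[\theta_0,\theta_1]$ is $i$-external if $\tilde e_i(b)=0$ whenever $\theta_i>0$, and $\tilde f_i(b)=0$ whenever $\theta_i<0$. A weight $\lambda\in P(\Lambda)$ is $i$-external if every $b\in B(\Lambda)$ of weight $\lambda$ is $i$-external. *)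

theory Defs
  imports
    Complex_Main
    "HOL-Library.Product_Plus"
    "HOL-Computational_Algebra.Polynomial"
    "HOL-Computational_Algebra.Fraction_Field"
begin

section \<open>Weights of the affine Lie algebra of type A_1^(1)\<close>

datatype node = Node0 | Node1

text \<open>The triple (x0, x1, n) stands for the integral weight x0 Lambda_0 + x1 Lambda_1 + n delta.
  The triple (k0, k1, l) stands for k0 h_0 + k1 h_1 + l d in the dual weight lattice, where
  h_i is the coroot of alpha_i and the scaling element d satisfies Lambda_i(d) = 0, delta(d) = 1.
  All weights of a highest weight module with highest weight a0 Lambda_0 + a1 Lambda_1 are of
  this integral form.\<close>

type_synonym weight = "int \<times> int \<times> int"
type_synonym coweight = "int \<times> int \<times> int"

fun weight_scale :: "int \<Rightarrow> weight \<Rightarrow> weight" (infixr "\<odot>" 75) where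
  "c \<odot> (x0, x1, n) = (c * x0, c * x1, c * n)"

fun fund :: "node \<Rightarrow> weight" where
  "fund Node0 = (1, 0, 0)"
| "fund Node1 = (0, 1, 0)"

definition null_root :: weight where
  "null_root = (0, 0, 1)"

fun simple_root :: "node \<Rightarrow> weight" where
  "simple_root Node0 = 2 \<odot> fund Node0 - 2 \<odot> fund Node1 + null_root"
| "simple_root Node1 = (- 2) \<odot> fund Node0 + 2 \<odot> fund Node1"

fun coroot :: "node \<Rightarrow> coweight" where
  "coroot Node0 = (1, 0, 0)"
| "coroot Node1 = (0, 1, 0)"

fun pairing :: "weight \<Rightarrow> coweight \<Rightarrow> int" where
  "pairing (x0, x1, n) (k0, k1, l) = x0 * k0 + x1 * k1 + n * l"

text \<open>The standard form, normalised by (Lambda_0 | Lambda_j) = 0. It is then determined by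
  (Lambda_1 | Lambda_1) = 1/2, (Lambda_i | delta) = 1, (delta | delta) = 0.\<close>

fun form :: "weight \<Rightarrow> weight \<Rightarrow> rat" where
  "form (x0, x1, n) (y0, y1, k) =
     of_int (x1 * y1) / 2 + of_int ((x0 + x1) * k + n * (y0 + y1))"

lemma form_simple_root: "form lam (simple_root i) = of_int (pairing lam (coroot i))"
  by (cases lam; cases i) (simp_all add: null_root_def)

lemma null_root_eq: "null_root = simple_root Node0 + simple_root Node1"
  by (simp add: null_root_def zero_prod_def)

definition hub :: "weight \<Rightarrow> node \<Rightarrow> int" where
  "hub lam i = pairing lam (coroot i)"

definition degree_below :: "weight \<Rightarrow> weight \<Rightarrow> int" where
  "degree_below Lam lam =
     (THE n. \<exists>c0 c1 :: nat.
        lam = Lam - (int c0 \<odot> simple_root Node0 + int c1 \<odot> simple_root Node1) \<and>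
        n = int c0 + int c1)"

definition defect :: "weight \<Rightarrow> weight \<Rightarrow> rat" where
  "defect Lam lam = (form Lam Lam - form lam lam) / 2"

definition commutator ::
  "('v \<Rightarrow> 'v) \<Rightarrow> ('v \<Rightarrow> 'v) \<Rightarrow> 'v \<Rightarrow> 'v::ab_group_add" where
  "commutator X Y = (\<lambda>v. X (Y v) - Y (X v))"


section \<open>Modules over the affine Lie algebra\<close>

text \<open>A module is given by the action of the Chevalley generators e_i, f_i and of the coweight
  lattice, whose complexification is the Cartan subalgebra, subject to the defining
  (Chevalley-Serre) relations. The vector space is the whole type.\<close>

locale affine_module = vector_space scale
  for scale :: "complex \<Rightarrow> 'v::ab_group_add \<Rightarrow> 'v" +
  fixes E F :: "node \<Rightarrow> 'v \<Rightarrow> 'v"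
    and H :: "coweight \<Rightarrow> 'v \<Rightarrow> 'v"
  assumes linear_E: "Vector_Spaces.linear scale scale (E i)"
    and linear_F: "Vector_Spaces.linear scale scale (F i)"
    and linear_H: "Vector_Spaces.linear scale scale (H h)"
    and H_add: "H (h + h') v = H h v + H h' v"
    and H_H: "commutator (H h) (H h') = (\<lambda>v. 0)"
    and H_E: "commutator (H h) (E i) = (\<lambda>v. scale (of_int (pairing (simple_root i) h)) (E i v))"
    and H_F: "commutator (H h) (F i) = (\<lambda>v. scale (- of_int (pairing (simple_root i) h)) (F i v))"
    and E_F: "commutator (E i) (F j) = (if i = j then H (coroot i) else (\<lambda>v. 0))"
    and Serre_E: "i \<noteq> j \<Longrightarrow>
      (commutator (E i) ^^ nat (1 - pairing (simple_root j) (coroot i))) (E j) = (\<lambda>v. 0)"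
    and Serre_F: "i \<noteq> j \<Longrightarrow>
      (commutator (F i) ^^ nat (1 - pairing (simple_root j) (coroot i))) (F j) = (\<lambda>v. 0)"
begin

definition weight_space :: "weight \<Rightarrow> 'v set" where
  "weight_space lam = {v. \<forall>h. H h v = scale (of_int (pairing lam h)) v}"

definition weights :: "weight set" where
  "weights = {lam. weight_space lam \<noteq> {0}}"

definition submodule :: "'v set \<Rightarrow> bool" where
  "submodule W \<longleftrightarrow> subspace W \<and>
     (\<forall>w\<in>W. (\<forall>i. E i w \<in> W \<and> F i w \<in> W) \<and> (\<forall>h. H h w \<in> W))"

text \<open>The highest weight vector generates the module because of irreducibility.\<close>

definition irreducible_highest_weight :: "weight \<Rightarrow> bool" where
  "irreducible_highest_weight Lam \<longleftrightarrow>
     (\<exists>v\<in>weight_space Lam. v \<noteq> 0 \<and> (\<forall>i. E i v = 0)) \<and>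
     (\<forall>W. submodule W \<longrightarrow> W = {0} \<or> W = UNIV)"

end


section \<open>Maximal weights and the functions s and N'\<close>

definition maximal_weights :: "weight set \<Rightarrow> weight set" where
  "maximal_weights P = {lam \<in> P. lam + null_root \<notin> P}"

definition s_fun :: "weight set \<Rightarrow> weight \<Rightarrow> int \<Rightarrow> int" where
  "s_fun P Lam m =
     (THE k. Lam - m \<odot> simple_root Node1 - k \<odot> null_root \<in> maximal_weights P)"

definition m_zero :: "nat \<Rightarrow> nat \<Rightarrow> int" where
  "m_zero a0 d = - \<lceil>(of_nat d + of_nat a0) / 2 :: rat\<rceil>"

definition m_one :: "nat \<Rightarrow> nat \<Rightarrow> int" where
  "m_one a1 d = \<lceil>(of_nat d + of_nat a1) / 2 :: rat\<rceil>"

definition N_prime :: "weight set \<Rightarrow> nat \<Rightarrow> nat \<Rightarrow> nat \<Rightarrow> int" where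
  "N_prime P a0 a1 d =
     (let Lam = int a0 \<odot> fund Node0 + int a1 \<odot> fund Node1 in
      max (2 * s_fun P Lam (m_zero a0 d) + m_zero a0 d)
          (2 * s_fun P Lam (m_one a1 d) + m_one a1 d))"


section \<open>Modules over the quantum affine algebra\<close>

type_synonym qfield = "rat poly fract"

definition q :: qfield where
  "q = Fract [:0, 1:] 1"

definition q_int :: "nat \<Rightarrow> qfield" where
  "q_int n = (q ^ n - inverse q ^ n) / (q - inverse q)"

definition q_fact :: "nat \<Rightarrow> qfield" where
  "q_fact n = (\<Prod>k=1..n. q_int k)"

text \<open>The rational functions regular at q = 0.\<close>

definition A_zero :: "qfield set" where
  "A_zero = {Fract f g | f g. poly g 0 \<noteq> 0}"

text \<open>T h is the action of q^h. The Serre relations are written with divided powers.\<close>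

locale quantum_affine_module = vector_space scale
  for scale :: "qfield \<Rightarrow> 'm::ab_group_add \<Rightarrow> 'm" +
  fixes E F :: "node \<Rightarrow> 'm \<Rightarrow> 'm"
    and T :: "coweight \<Rightarrow> 'm \<Rightarrow> 'm"
  assumes linear_E: "Vector_Spaces.linear scale scale (E i)"
    and linear_F: "Vector_Spaces.linear scale scale (F i)"
    and linear_T: "Vector_Spaces.linear scale scale (T h)"
    and T_zero: "T 0 v = v"
    and T_add: "T (h + h') v = T h (T h' v)"
    and T_E: "T h (E i (T (- h) v)) = scale (q powi pairing (simple_root i) h) (E i v)"
    and T_F: "T h (F i (T (- h) v)) = scale (q powi (- pairing (simple_root i) h)) (F i v)"
    and E_F: "E i (F j v) - F j (E i v) =
      (if i = j then scale (1 / (q - inverse q)) (T (coroot i) v - T (- coroot i) v) else 0)"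
    and Serre_E: "i \<noteq> j \<Longrightarrow> N = nat (1 - pairing (simple_root j) (coroot i)) \<Longrightarrow>
      (\<Sum>k\<le>N. scale ((- 1) ^ k / (q_fact (N - k) * q_fact k))
                ((E i ^^ (N - k)) (E j ((E i ^^ k) v)))) = 0"
    and Serre_F: "i \<noteq> j \<Longrightarrow> N = nat (1 - pairing (simple_root j) (coroot i)) \<Longrightarrow>
      (\<Sum>k\<le>N. scale ((- 1) ^ k / (q_fact (N - k) * q_fact k))
                ((F i ^^ (N - k)) (F j ((F i ^^ k) v)))) = 0"
begin

definition weight_space :: "weight \<Rightarrow> 'm set" where
  "weight_space lam = {v. \<forall>h. T h v = scale (q powi pairing lam h) v}"

definition submodule :: "'m set \<Rightarrow> bool" where
  "submodule W \<longleftrightarrow> subspace W \<and>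
     (\<forall>w\<in>W. (\<forall>i. E i w \<in> W \<and> F i w \<in> W) \<and> (\<forall>h. T h w \<in> W))"

definition irreducible_highest_weight :: "weight \<Rightarrow> bool" where
  "irreducible_highest_weight Lam \<longleftrightarrow>
     (\<exists>v\<in>weight_space Lam. v \<noteq> 0 \<and> (\<forall>i. E i v = 0)) \<and>
     (\<forall>W. submodule W \<longrightarrow> W = {0} \<or> W = UNIV)"

definition F_divided :: "node \<Rightarrow> nat \<Rightarrow> 'm \<Rightarrow> 'm" where
  "F_divided i n v = scale (1 / q_fact n) ((F i ^^ n) v)"

text \<open>An integrable module is the direct sum of the spaces f_i^(n) (ker e_i Int M_lam) over all
  lam and all n with 0 <= n <= lam(h_i), and f_i^(n) is injective on each of these kernels. The
  Kashiwara operators are the linear operators that lower, respectively raise, n by one.\<close>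

definition kashiwara_e :: "node \<Rightarrow> 'm \<Rightarrow> 'm" where
  "kashiwara_e i = (THE g. Vector_Spaces.linear scale scale g \<and>
     (\<forall>lam u n. u \<in> weight_space lam \<and> E i u = 0 \<and> int n \<le> pairing lam (coroot i) \<longrightarrow>
        g (F_divided i n u) = (if n = 0 then 0 else F_divided i (n - 1) u)))"

definition kashiwara_f :: "node \<Rightarrow> 'm \<Rightarrow> 'm" where
  "kashiwara_f i = (THE g. Vector_Spaces.linear scale scale g \<and>
     (\<forall>lam u n. u \<in> weight_space lam \<and> E i u = 0 \<and> int n \<le> pairing lam (coroot i) \<longrightarrow>
        g (F_divided i n u) = F_divided i (n + 1) u))"


subsection \<open>Crystal bases\<close>

text \<open>A free module over A_zero whose scalar extension is the whole space is the same as the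
  A_zero-span of a basis of that space.\<close>

definition crystal_lattice :: "'m set \<Rightarrow> bool" where
  "crystal_lattice L \<longleftrightarrow>
     (\<exists>S. independent S \<and> span S = UNIV \<and>
        L = {(\<Sum>x\<in>X. scale (c x) x) | X c. finite X \<and> X \<subseteq> S \<and> c ` X \<subseteq> A_zero}) \<and>
     (\<forall>v\<in>L. \<exists>Q w. finite Q \<and> (\<forall>lam\<in>Q. w lam \<in> L \<inter> weight_space lam) \<and>
        v = (\<Sum>lam\<in>Q. w lam)) \<and>
     (\<forall>i. \<forall>v\<in>L. kashiwara_e i v \<in> L \<and> kashiwara_f i v \<in> L)"

text \<open>Elements of L / qL are represented as cosets of qL, so its zero element is qL itself,
  which is the coset of 0.\<close>

definition coset :: "'m set \<Rightarrow> 'm \<Rightarrow> 'm set" where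
  "coset L v = {v + scale q x | x. x \<in> L}"

definition induced :: "'m set \<Rightarrow> ('m \<Rightarrow> 'm) \<Rightarrow> 'm set \<Rightarrow> 'm set" where
  "induced L g b = (\<Union>v\<in>b. coset L (g v))"

definition has_weight :: "'m set \<Rightarrow> 'm set \<Rightarrow> weight \<Rightarrow> bool" where
  "has_weight L b lam \<longleftrightarrow> (\<exists>v \<in> L \<inter> weight_space lam. b = coset L v)"

text \<open>Since A_zero / q A_zero is the field of rationals, L / qL is a rational vector space, in
  which a linear combination of cosets is computed on representatives. The rational number x is
  embedded into the field of rational functions as Fract [:x:] 1.\<close>

definition quotient_basis :: "'m set \<Rightarrow> 'm set set \<Rightarrow> bool" where
  "quotient_basis L B \<longleftrightarrow> B \<subseteq> coset L ` L \<and>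
     (\<forall>v\<in>L. \<exists>!c :: 'm set \<Rightarrow> rat. finite {b. c b \<noteq> 0} \<and> {b. c b \<noteq> 0} \<subseteq> B \<and>
        coset L v = coset L (\<Sum>b | c b \<noteq> 0. scale (Fract [:c b:] 1) (SOME w. w \<in> b)))"

definition crystal_base :: "'m set \<Rightarrow> 'm set set \<Rightarrow> bool" where
  "crystal_base L B \<longleftrightarrow> crystal_lattice L \<and> quotient_basis L B \<and>
     (\<forall>b\<in>B. \<exists>lam. has_weight L b lam) \<and>
     (\<forall>i. \<forall>b\<in>B. induced L (kashiwara_e i) b \<in> B \<union> {coset L 0} \<and>
                induced L (kashiwara_f i) b \<in> B \<union> {coset L 0}) \<and>
     (\<forall>i. \<forall>b\<in>B. \<forall>b'\<in>B.
        induced L (kashiwara_f i) b = b' \<longleftrightarrow> induced L (kashiwara_e i) b' = b)"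

definition external_element :: "'m set \<Rightarrow> node \<Rightarrow> weight \<Rightarrow> 'm set \<Rightarrow> bool" where
  "external_element L i lam b \<longleftrightarrow>
     (hub lam i > 0 \<longrightarrow> induced L (kashiwara_e i) b = coset L 0) \<and>
     (hub lam i < 0 \<longrightarrow> induced L (kashiwara_f i) b = coset L 0)"

definition external_weight :: "'m set \<Rightarrow> 'm set set \<Rightarrow> node \<Rightarrow> weight \<Rightarrow> bool" where
  "external_weight L B i lam \<longleftrightarrow>
     (\<forall>b\<in>B. has_weight L b lam \<longrightarrow> external_element L i lam b)"

end

end

theory Submission
  imports Defs
begin

text \<open>A weight \<open>Lam - m alpha_1 - k delta\<close> has defect \<open>m (a1 - m) + k r\<close> and hub
  \<open>[a0 + 2 m, a1 - 2 m]\<close>. Adding \<open>alpha_i\<close> lowers the defect by \<open>theta_i + 1\<close>, and subtracting it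
  raises the defect by \<open>theta_i - 1\<close>. Since no weight has negative defect, a weight of defect \<open>d\<close>
  is external as soon as \<open>d \<le> \<bar>theta_i\<bar>\<close> for both \<open>i\<close>, that is, as soon as \<open>m \<le> m_0\<close> or
  \<open>m_1 \<le> m\<close>. For fixed defect the degree is a convex function of \<open>m\<close>, and for \<open>m_0 < m < m_1\<close>
  it stays below \<open>N'\<close> because the maximal weights of the columns \<open>m_0\<close> and \<open>m_1\<close> have nonnegative
  defect.\<close>

text \<open>The hypotheses give irreducibility and the Chevalley-Serre relations, while
  nonnegativity of the defect rests on Weyl reflections, hence on integrability. Integrability is
  therefore derived: a singular vector generates the irreducible module, so its weight is
  \<open>Lam\<close>; with the Serre relations this forces local nilpotency of each
  \<open>F i\<close>. \<open>P\<close> and \<open>s_fun\<close> belong to the Lie algebra module,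
  the crystal to the quantum module. The link is the common highest weight: the bound on the defect
  is proved once, for scalars \<open>br n\<close> covering both cases, and applied to each module.
  \<open>s_fun\<close>, \<open>kashiwara_e\<close> and \<open>kashiwara_f\<close> are definite
  descriptions, so facts about them require unique existence. For the Kashiwara operators this is
  the unique decomposition into sl_2 strings. For \<open>s_fun\<close> it is that every column
  (fixed m, varying multiple of delta) contains weights, bounded above, and that these are closed
  under subtracting delta; nonemptiness comes from translations in the affine Weyl group, closure
  from a Heisenberg subalgebra.\<close>

text \<open>Weights are triples; without this declaration the simplifier splits quantifiers over them
  into components.\<close>

declare split_paired_All [simp del] split_paired_Ex [simp del]

section \<open>Linear algebra on weight triples\<close>

lemma fst_weight_scale [simp]: "fst (c \<odot> x) = c * fst x"
  by (cases x) simp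

lemma fst_snd_weight_scale [simp]: "fst (snd (c \<odot> x)) = c * fst (snd x)"
  by (cases x) simp

lemma snd_snd_weight_scale [simp]: "snd (snd (c \<odot> x)) = c * snd (snd x)"
  by (cases x) simp

lemma weight_eqI:
  fixes x y :: weight
  assumes "fst x = fst y" "fst (snd x) = fst (snd y)" "snd (snd x) = snd (snd y)"
  shows "x = y"
  using assms by (simp add: prod_eq_iff)

lemma weight_scale_simps:
  "0 \<odot> x = 0" "1 \<odot> x = x" "(c + d) \<odot> x = c \<odot> x + d \<odot> x" "(c - d) \<odot> x = c \<odot> x - d \<odot> x"
  by (auto intro!: weight_eqI simp: algebra_simps)

lemma hub_add [simp]: "hub (x + y) i = hub x i + hub y i"
  by (cases x; cases y; cases i) (simp_all add: hub_def)

lemma hub_diff [simp]: "hub (x - y) i = hub x i - hub y i"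
  by (cases x; cases y; cases i) (simp_all add: hub_def)

lemma hub_scale [simp]: "hub (c \<odot> x) i = c * hub x i"
  by (cases x; cases i) (simp_all add: hub_def)

lemma hub_simple_root [simp]: "hub (simple_root i) j = (if i = j then 2 else - 2)"
  by (cases i; cases j) (simp_all add: hub_def null_root_def)

lemma hub_null_root [simp]: "hub null_root i = 0"
  by (cases i) (simp_all add: hub_def null_root_def)

lemma pairing_add: "pairing (x + y) h = pairing x h + pairing y h"
  by (cases x; cases y; cases h) (simp add: algebra_simps)

lemma pairing_diff: "pairing (x - y) h = pairing x h - pairing y h"
  by (cases x; cases y; cases h) (simp add: algebra_simps)

lemma pairing_uminus: "pairing x (- h) = - pairing x h"
  by (cases x; cases h) (simp add: algebra_simps)

lemma pairing_separates:
  assumes "x \<noteq> y"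
  obtains h where "pairing x h \<noteq> pairing y h"
proof -
  have "\<not> (pairing x (1,0,0) = pairing y (1,0,0) \<and> pairing x (0,1,0) = pairing y (0,1,0)
      \<and> pairing x (0,0,1) = pairing y (0,0,1))"
    using assms by (cases x; cases y) auto
  then show thesis using that by blast
qed

lemma form_add_left: "form (x + y) z = form x z + form y z"
  by (cases x; cases y; cases z) (simp add: field_simps)

lemma form_add_right: "form x (y + z) = form x y + form x z"
  by (cases x; cases y; cases z) (simp add: field_simps)

lemma form_diff_left: "form (x - y) z = form x z - form y z"
  by (cases x; cases y; cases z) (simp add: field_simps)

lemma form_diff_right: "form x (y - z) = form x y - form x z"
  by (cases x; cases y; cases z) (simp add: field_simps)

lemma form_scale_left: "form (c \<odot> x) z = of_int c * form x z"
  by (cases x; cases z) (simp add: field_simps)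

lemma form_scale_right: "form x (c \<odot> z) = of_int c * form x z"
  by (cases x; cases z) (simp add: field_simps)

lemma form_sym: "form x y = form y x"
  by (cases x; cases y) (simp add: field_simps)

lemma form_simple_root_hub: "form x (simple_root i) = of_int (hub x i)"
  by (simp add: form_simple_root hub_def)

section \<open>The cone of weights below a given one\<close>

definition below :: "weight \<Rightarrow> weight set" where
  "below mu = {mu - (int c0 \<odot> simple_root Node0 + int c1 \<odot> simple_root Node1) | c0 c1. True}"

text \<open>Only \<open>simple_root Node0\<close> contains delta, so the last coordinate determines
  \<open>c0\<close> and the others then determine \<open>c1\<close>.\<close>

lemma below_iff:
  "lam \<in> below mu \<longleftrightarrow> (\<exists>c0 c1 :: nat. fst lam = fst mu - 2 * int c0 + 2 * int c1 \<and>
     fst (snd lam) = fst (snd mu) + 2 * int c0 - 2 * int c1 \<and> snd (snd lam) = snd (snd mu) - int c0)"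
  by (auto simp: below_def prod_eq_iff null_root_def)

lemma below_refl: "mu \<in> below mu"
  unfolding below_iff by (intro exI[of _ 0]) simp

lemma below_antisym:
  assumes "lam \<in> below mu" "mu \<in> below lam"
  shows "lam = mu"
proof -
  obtain c0 c1 d0 d1 :: nat where
    "fst lam = fst mu - 2 * int c0 + 2 * int c1"
    "fst (snd lam) = fst (snd mu) + 2 * int c0 - 2 * int c1" "snd (snd lam) = snd (snd mu) - int c0"
    "fst mu = fst lam - 2 * int d0 + 2 * int d1"
    "fst (snd mu) = fst (snd lam) + 2 * int d0 - 2 * int d1" "snd (snd mu) = snd (snd lam) - int d0"
    using assms unfolding below_iff by blast
  then show ?thesis by (intro weight_eqI) linarith+
qed

lemma below_simple_root:
  assumes "lam \<in> below mu"
  shows "lam - simple_root i \<in> below mu"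
proof -
  obtain c0 c1 :: nat where "fst lam = fst mu - 2 * int c0 + 2 * int c1"
    "fst (snd lam) = fst (snd mu) + 2 * int c0 - 2 * int c1" "snd (snd lam) = snd (snd mu) - int c0"
    using assms unfolding below_iff by blast
  then show ?thesis unfolding below_iff
    by (cases i) (rule exI[of _ "Suc c0"], rule exI[of _ c1], simp add: null_root_def,
        rule exI[of _ c0], rule exI[of _ "Suc c1"], simp add: null_root_def)
qed

lemma eventually_not_below: "\<exists>n :: nat. lam + int n \<odot> simple_root i \<notin> below mu"
proof (rule ccontr)
  assume all: "\<not> ?thesis"
  \<comment> \<open>The first summand defeats \<open>Node1\<close>, where \<open>c0\<close> is fixed
    and \<open>c1\<close> decreases with \<open>n\<close>; the second defeats \<open>Node0\<close>,
    where \<open>c0\<close> decreases.\<close>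
  define n where "n = nat (fst lam - fst mu + 2 * (snd (snd mu) - snd (snd lam)))
    + nat (snd (snd mu) - snd (snd lam)) + 1"
  have "lam + int n \<odot> simple_root i \<in> below mu" using all by blast
  then obtain c0 c1 :: nat where
    "fst lam + int n * fst (simple_root i) = fst mu - 2 * int c0 + 2 * int c1"
    "snd (snd lam) + int n * snd (snd (simple_root i)) = snd (snd mu) - int c0"
    unfolding below_iff by auto
  moreover have "int n > fst lam - fst mu + 2 * (snd (snd mu) - snd (snd lam))"
    "int n > snd (snd mu) - snd (snd lam)" "int n > 0"
    unfolding n_def by linarith+
  ultimately show False
    by (cases i) (auto simp: null_root_def)
qed

section \<open>Weight spaces\<close>

text \<open>The eigenvalue map \<open>chi\<close> is \<open>of_int\<close> for the Lie algebra and
  \<open>q powi n\<close> for the quantum algebra. Its injectivity turns distinct weights into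
  distinct eigenvalues of some \<open>T h\<close>.\<close>

locale torus_module = vector_space scale
  for scale :: "'k::field \<Rightarrow> 'v::ab_group_add \<Rightarrow> 'v" +
  fixes T :: "coweight \<Rightarrow> 'v \<Rightarrow> 'v" and chi :: "int \<Rightarrow> 'k"
  assumes linear_T: "Vector_Spaces.linear scale scale (T h)"
    and inj_chi: "inj chi"
begin

definition wsp :: "weight \<Rightarrow> 'v set" where
  "wsp lam = {v. \<forall>h. T h v = scale (chi (pairing lam h)) v}"

lemmas T_add = module_hom.add[OF Vector_Spaces.linear.axioms(3)[OF linear_T]]
lemmas T_scale = module_hom.scale[OF Vector_Spaces.linear.axioms(3)[OF linear_T]]
lemmas T_0 = module_hom.zero[OF Vector_Spaces.linear.axioms(3)[OF linear_T]]
lemmas T_sum = module_hom.sum[OF Vector_Spaces.linear.axioms(3)[OF linear_T]]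

lemma wsp_T: "v \<in> wsp lam \<Longrightarrow> T h v = scale (chi (pairing lam h)) v"
  by (simp add: wsp_def)

lemma subspace_wsp: "subspace (wsp lam)"
  unfolding subspace_def wsp_def
  by (auto simp: T_0 T_add T_scale scale_right_distrib mult.commute)

text \<open>For each other weight \<open>nu\<close>, an \<open>h\<close> separating it from
  \<open>lam\<close> is chosen; \<open>T h\<close> minus its eigenvalue on \<open>lam\<close>
  removes the \<open>lam\<close> term and multiplies the \<open>nu\<close> term by a nonzero scalar,
  so the induction hypothesis applies to the rescaled family.\<close>

lemma wsp_sum_eq_0:
  assumes "finite A" "\<And>nu. nu \<in> A \<Longrightarrow> w nu \<in> wsp nu" "(\<Sum>nu\<in>A. w nu) = 0" "nu \<in> A"
  shows "w nu = 0"
  using assms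
proof (induction A arbitrary: w nu rule: finite_induct)
  case (insert lam A)
  have zero: "w nu = 0" if "nu \<in> A" for nu
  proof -
    have "lam \<noteq> nu" using insert.hyps that by blast
    then obtain h where h: "pairing lam h \<noteq> pairing nu h"
      by (rule pairing_separates)
    let ?c = "\<lambda>nu. chi (pairing nu h) - chi (pairing lam h)"
    have "(\<Sum>nu\<in>insert lam A. T h (w nu)) = 0"
      using insert.prems(2) by (metis T_0 T_sum)
    moreover have "(\<Sum>nu\<in>insert lam A. T h (w nu)) = (\<Sum>nu\<in>insert lam A. scale (chi (pairing nu h)) (w nu))"
      using insert.prems(1) by (intro sum.cong wsp_T) auto
    ultimately have "(\<Sum>nu\<in>insert lam A. scale (chi (pairing nu h)) (w nu)) = 0" by simp
    moreover have "(\<Sum>nu\<in>insert lam A. scale (chi (pairing lam h)) (w nu)) = 0"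
      using insert.prems(2) by (metis scale_sum_right scale_zero_right)
    ultimately have "(\<Sum>nu\<in>insert lam A. scale (?c nu) (w nu)) = 0"
      by (simp only: scale_left_diff_distrib sum_subtractf diff_0_right)
    then have "(\<Sum>nu\<in>A. scale (?c nu) (w nu)) = 0"
      using insert.hyps by simp
    then have "scale (?c nu) (w nu) = 0"
      by (rule insert.IH[of "\<lambda>nu. scale (?c nu) (w nu)", rotated])
        (use insert.prems(1) that in \<open>auto intro!: subspace_scale[OF subspace_wsp]\<close>)
    then show ?thesis
      using h inj_chi by (auto simp: inj_eq)
  qed
  then have "w lam = 0"
    using insert.prems(2) insert.hyps by (simp add: sum.neutral)
  then show ?case using zero insert.prems(3) by blast
qed simp

lemma span_wsp_disjoint:
  assumes "v \<in> span (\<Union>nu\<in>A. wsp nu)" "v \<in> wsp lam" "lam \<notin> A"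
  shows "v = 0"
proof -
  have "\<exists>K w. finite K \<and> K \<subseteq> A \<and> (\<forall>nu. w nu \<in> wsp nu) \<and> v = (\<Sum>nu\<in>K. w nu)"
    using assms(1)
  proof (induction rule: span_induct_alt)
    case base
    show ?case
      by (rule exI[of _ "{}"], rule exI[of _ "\<lambda>_. 0"]) (simp add: subspace_0[OF subspace_wsp])
  next
    case (step c x y)
    then obtain nu K w where nu: "nu \<in> A" "x \<in> wsp nu"
      and K: "finite K" "K \<subseteq> A" "\<forall>nu. w nu \<in> wsp nu" "y = (\<Sum>nu\<in>K. w nu)" by blast
    let ?g = "\<lambda>mu. if mu \<in> K then w mu else 0"
    let ?h = "?g(nu := ?g nu + scale c x)"
    have "y = (\<Sum>mu\<in>insert nu K. ?g mu)"
      unfolding K(4) by (rule sum.mono_neutral_cong_left) (use K(1) in auto)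
    also have "\<dots> = ?g nu + (\<Sum>mu\<in>insert nu K - {nu}. ?g mu)"
      using K(1) by (subst sum.remove[of _ nu]) auto
    also have "(\<Sum>mu\<in>insert nu K - {nu}. ?g mu) = (\<Sum>mu\<in>insert nu K - {nu}. ?h mu)"
      by (intro sum.cong) auto
    finally have "scale c x + y = ?h nu + (\<Sum>mu\<in>insert nu K - {nu}. ?h mu)"
      by (simp only: fun_upd_same ac_simps)
    also have "\<dots> = (\<Sum>mu\<in>insert nu K. ?h mu)"
      using K(1) by (subst sum.remove[of "insert nu K" nu]) auto
    finally have "scale c x + y = (\<Sum>mu\<in>insert nu K. ?h mu)" .
    moreover have "\<forall>mu. ?h mu \<in> wsp mu"
      using nu K(3) by (auto intro: subspace_add subspace_scale subspace_0 subspace_wsp)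
    ultimately show ?case using K nu by (intro exI[of _ "insert nu K"] exI[of _ ?h]) auto
  qed
  then obtain K w where K: "finite K" "K \<subseteq> A" "\<And>nu. w nu \<in> wsp nu" "v = (\<Sum>nu\<in>K. w nu)" by blast
  \<comment> \<open>The expansion of \<open>v\<close> becomes a vanishing sum over
    \<open>insert lam K\<close> with entry \<open>- v\<close> at \<open>lam\<close>.\<close>
  let ?w = "w(lam := - v)"
  have "(\<Sum>nu\<in>insert lam K. ?w nu) = - v + (\<Sum>nu\<in>K. ?w nu)"
    using K(1,2) assms(3) by (subst sum.insert) auto
  also have "(\<Sum>nu\<in>K. ?w nu) = v"
    unfolding K(4) using K(2) assms(3) by (intro sum.cong) auto
  finally have "(\<Sum>nu\<in>insert lam K. ?w nu) = 0" by simp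
  then have "?w lam = 0"
    by (intro wsp_sum_eq_0[of "insert lam K" ?w lam])
      (use K assms(2) in \<open>auto intro: subspace_neg[OF subspace_wsp]\<close>)
  then show ?thesis by simp
qed

end

section \<open>Integrable highest weight modules\<close>

text \<open>The scalars \<open>br n\<close> stand for the integers in the classical case and for the \<open>q\<close>-integers
  \<open>[n]\<close> in the quantum case, so that both kinds of modules are instances of this locale.\<close>

locale hw_module = torus_module scale T chi
  for scale :: "'k::field \<Rightarrow> 'v::ab_group_add \<Rightarrow> 'v"
    and T :: "coweight \<Rightarrow> 'v \<Rightarrow> 'v" and chi :: "int \<Rightarrow> 'k" +
  fixes E F :: "node \<Rightarrow> 'v \<Rightarrow> 'v" and br :: "int \<Rightarrow> 'k" and Lam :: weight
  assumes linear_E: "Vector_Spaces.linear scale scale (E i)"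
    and linear_F: "Vector_Spaces.linear scale scale (F i)"
    and br_eq_0_iff: "br n = 0 \<longleftrightarrow> n = 0"
    and br_shift: "br (a + 1) * br b = br a * br (b + 1) + br (b - a)"
    and E_wsp: "v \<in> wsp lam \<Longrightarrow> E i v \<in> wsp (lam + simple_root i)"
    and F_wsp: "v \<in> wsp lam \<Longrightarrow> F i v \<in> wsp (lam - simple_root i)"
    and E_F: "v \<in> wsp lam \<Longrightarrow>
      E i (F j v) = F j (E i v) + (if i = j then scale (br (hub lam i)) v else 0)"
    and Serre: "i \<noteq> j \<Longrightarrow> \<exists>a b c. \<forall>v. F i (F i (F i (F j v))) =
      scale a (F i (F i (F j (F i v)))) + scale b (F i (F j (F i (F i v)))) +
      scale c (F j (F i (F i (F i v))))"
    and highest_weight: "\<exists>v\<in>wsp Lam. v \<noteq> 0 \<and> (\<forall>i. E i v = 0)"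
    and irreducible: "subspace W \<Longrightarrow> (\<And>w i. w \<in> W \<Longrightarrow> E i w \<in> W) \<Longrightarrow>
      (\<And>w i. w \<in> W \<Longrightarrow> F i w \<in> W) \<Longrightarrow> (\<And>w h. w \<in> W \<Longrightarrow> T h w \<in> W) \<Longrightarrow> W = {0} \<or> W = UNIV"
    and dominant: "0 \<le> hub Lam i"
begin

lemmas E_add = module_hom.add[OF Vector_Spaces.linear.axioms(3)[OF linear_E]]
lemmas E_scale = module_hom.scale[OF Vector_Spaces.linear.axioms(3)[OF linear_E]]
lemmas E_0 = module_hom.zero[OF Vector_Spaces.linear.axioms(3)[OF linear_E]]
lemmas E_diff = module_hom.diff[OF Vector_Spaces.linear.axioms(3)[OF linear_E]]
lemmas F_add = module_hom.add[OF Vector_Spaces.linear.axioms(3)[OF linear_F]]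
lemmas F_scale = module_hom.scale[OF Vector_Spaces.linear.axioms(3)[OF linear_F]]
lemmas F_0 = module_hom.zero[OF Vector_Spaces.linear.axioms(3)[OF linear_F]]
lemmas F_diff = module_hom.diff[OF Vector_Spaces.linear.axioms(3)[OF linear_F]]

lemma linear_endoI:
  "(\<And>x y. f (x + y) = f x + f y) \<Longrightarrow> (\<And>c x. f (scale c x) = scale c (f x)) \<Longrightarrow>
    Vector_Spaces.linear scale scale f"
  by (simp add: Vector_Spaces.linear_iff vector_space_axioms)

lemma linear_E_pow: "Vector_Spaces.linear scale scale (E i ^^ n)"
proof (rule linear_endoI)
  show "(E i ^^ n) (x + y) = (E i ^^ n) x + (E i ^^ n) y" for x y
    by (induction n) (simp_all add: E_add)
  show "(E i ^^ n) (scale c x) = scale c ((E i ^^ n) x)" for c x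
    by (induction n) (simp_all add: E_scale)
qed

lemma linear_F_pow: "Vector_Spaces.linear scale scale (F i ^^ n)"
proof (rule linear_endoI)
  show "(F i ^^ n) (x + y) = (F i ^^ n) x + (F i ^^ n) y" for x y
    by (induction n) (simp_all add: F_add)
  show "(F i ^^ n) (scale c x) = scale c ((F i ^^ n) x)" for c x
    by (induction n) (simp_all add: F_scale)
qed

lemmas E_pow_0 = module_hom.zero[OF Vector_Spaces.linear.axioms(3)[OF linear_E_pow]]
lemmas E_pow_scale = module_hom.scale[OF Vector_Spaces.linear.axioms(3)[OF linear_E_pow]]
lemmas E_pow_sum = module_hom.sum[OF Vector_Spaces.linear.axioms(3)[OF linear_E_pow]]
lemmas F_pow_0 = module_hom.zero[OF Vector_Spaces.linear.axioms(3)[OF linear_F_pow]]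
lemmas F_pow_add = module_hom.add[OF Vector_Spaces.linear.axioms(3)[OF linear_F_pow]]
lemmas F_pow_scale = module_hom.scale[OF Vector_Spaces.linear.axioms(3)[OF linear_F_pow]]

lemma E_pow_wsp: "v \<in> wsp lam \<Longrightarrow> (E i ^^ n) v \<in> wsp (lam + int n \<odot> simple_root i)"
proof (induction n)
  case (Suc n)
  have "lam + int (Suc n) \<odot> simple_root i = lam + int n \<odot> simple_root i + simple_root i"
    by (rule weight_eqI) (simp_all add: algebra_simps)
  then show ?case using E_wsp[OF Suc.IH[OF Suc.prems], of i] by (simp only: funpow.simps comp_apply)
qed (simp add: weight_scale_simps)

lemma F_pow_wsp: "v \<in> wsp lam \<Longrightarrow> (F i ^^ n) v \<in> wsp (lam - int n \<odot> simple_root i)"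
proof (induction n)
  case (Suc n)
  have "lam - int (Suc n) \<odot> simple_root i = lam - int n \<odot> simple_root i - simple_root i"
    by (rule weight_eqI) (simp_all add: algebra_simps)
  then show ?case using F_wsp[OF Suc.IH[OF Suc.prems], of i] by (simp only: funpow.simps comp_apply)
qed (simp add: weight_scale_simps)

text \<open>Moving \<open>E i\<close> past one more \<open>F i\<close> adds
  \<open>br (hub lam i - 2 * (n + 1))\<close>; \<open>br_shift\<close> is exactly the identity that
  merges it with the previous coefficient.\<close>

lemma E_F_pow:
  assumes "v \<in> wsp lam"
  shows "E i ((F i ^^ Suc n) v) = (F i ^^ Suc n) (E i v)
    + scale (br (int n + 1) * br (hub lam i - int n)) ((F i ^^ n) v)"
proof (induction n)
  case 0
  show ?case using E_F[OF assms, of i i] br_shift[of 0 "hub lam i"] by (simp add: br_eq_0_iff)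
next
  case (Suc n)
  have "br (int (Suc n) + 1) * br (hub lam i - int (Suc n))
      = br (int n + 1) * br (hub lam i - int n) + br (hub lam i - 2 * int (Suc n))"
    using br_shift[of "int (Suc n)" "hub lam i - int (Suc n)"] by (simp add: algebra_simps)
  then show ?case
    using E_F[OF F_pow_wsp[OF assms, of "Suc n" i], of i i] Suc
    by (simp add: F_add F_scale scale_left_distrib algebra_simps)
qed

lemma E_F_pow_neq: "v \<in> wsp lam \<Longrightarrow> i \<noteq> j \<Longrightarrow> E j ((F i ^^ n) v) = (F i ^^ n) (E j v)"
proof (induction n)
  case (Suc n)
  then show ?case using E_F[OF F_pow_wsp[OF Suc.prems(1), of n i], of j i] by simp
qed simp

section \<open>Cyclicity and singular vectors\<close>

definition weights :: "weight set" where
  "weights = {lam. wsp lam \<noteq> {0}}"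

lemma weightsI: "v \<in> wsp lam \<Longrightarrow> v \<noteq> 0 \<Longrightarrow> lam \<in> weights"
  by (auto simp: weights_def)

lemma weightsE:
  assumes "lam \<in> weights"
  obtains v where "v \<in> wsp lam" "v \<noteq> 0"
  using assms subspace_0[OF subspace_wsp] unfolding weights_def by blast

inductive_set F_words :: "'v \<Rightarrow> 'v set" for u where
  F_words_base: "u \<in> F_words u"
| F_words_step: "w \<in> F_words u \<Longrightarrow> F i w \<in> F_words u"

lemma F_words_wsp: "w \<in> F_words u \<Longrightarrow> u \<in> wsp mu \<Longrightarrow> \<exists>nu\<in>below mu. w \<in> wsp nu"
  by (induction rule: F_words.induct) (use below_refl below_simple_root F_wsp in blast)+

lemma span_F_words_F:
  assumes "w \<in> span (F_words u)"
  shows "F i w \<in> span (F_words u)"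
  using assms
proof (induction rule: span_induct_alt)
  case base show ?case by (simp add: F_0 span_zero)
next
  case (step c x y)
  then show ?case
    by (simp add: F_add F_scale span_add span_scale span_base F_words_step)
qed

text \<open>\<open>E i\<close> is commuted through the leading letter; since words are weight
  vectors, the commutator contributes only a multiple of the shorter word.\<close>

lemma F_words_E:
  assumes "w \<in> F_words u" "u \<in> wsp mu" "\<And>i. E i u = 0"
  shows "E i w \<in> span (F_words u)"
  using assms
proof (induction rule: F_words.induct)
  case F_words_base then show ?case by (simp add: span_zero)
next
  case (F_words_step w j)
  obtain nu where "w \<in> wsp nu" using F_words_wsp F_words_step by blast
  then show ?case
    using E_F[of w nu i j] span_F_words_F[OF F_words_step.IH] F_words_step
    by (cases "i = j") (simp_all add: span_add span_scale span_base)
qed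

lemma span_F_words:
  assumes "u \<in> wsp mu" "u \<noteq> 0" "\<And>i. E i u = 0"
  shows "span (F_words u) = UNIV"
proof -
  let ?W = "span (F_words u)"
  have "E i w \<in> ?W" if "w \<in> ?W" for i w
    using that
  proof (induction rule: span_induct_alt)
    case base show ?case by (simp add: E_0 span_zero)
  next
    case (step c x y)
    then show ?case
      using F_words_E[OF _ assms(1,3)] by (simp add: E_add E_scale span_add span_scale)
  qed
  moreover have "T h w \<in> ?W" if "w \<in> ?W" for h w
    using that
  proof (induction rule: span_induct_alt)
    case base show ?case by (simp add: T_0 span_zero)
  next
    case (step c x y)
    then obtain nu where "x \<in> wsp nu" using F_words_wsp assms(1) by blast
    then show ?case
      using step by (simp add: T_add T_scale wsp_T span_add span_scale span_base)
  qed
  ultimately have "?W = {0} \<or> ?W = UNIV"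
    using span_F_words_F by (intro irreducible) auto
  then show ?thesis using assms(2) span_base[OF F_words_base, of u] by auto
qed

lemma weights_below:
  assumes "u \<in> wsp mu" "u \<noteq> 0" "\<And>i. E i u = 0" "lam \<in> weights"
  shows "lam \<in> below mu"
proof -
  obtain v where v: "v \<in> wsp lam" "v \<noteq> 0" using assms(4) by (rule weightsE)
  have "v \<in> span (F_words u)" using span_F_words[OF assms(1-3)] by simp
  moreover have "F_words u \<subseteq> (\<Union>nu\<in>below mu. wsp nu)"
    using F_words_wsp[OF _ assms(1)] by blast
  ultimately have "v \<in> span (\<Union>nu\<in>below mu. wsp nu)" using span_mono by blast
  then show ?thesis using span_wsp_disjoint v by blast
qed

lemma weights_below_Lam: "lam \<in> weights \<Longrightarrow> lam \<in> below Lam"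
  using highest_weight weights_below by blast

text \<open>By irreducibility the singular vector generates the module, so \<open>Lam\<close> lies
  below \<open>mu\<close>; as every weight lies below \<open>Lam\<close>, antisymmetry
  applies.\<close>

lemma singular_weight:
  assumes "u \<in> wsp mu" "u \<noteq> 0" "\<And>i. E i u = 0"
  shows "mu = Lam"
proof -
  have "Lam \<in> weights" using highest_weight weightsI by blast
  then show ?thesis
    using below_antisym weights_below[OF assms] weights_below_Lam[OF weightsI[OF assms(1,2)]] by blast
qed

section \<open>Local nilpotency\<close>

text \<open>The vector would be singular of weight other than \<open>Lam\<close>: \<open>E i\<close>
  kills it because the coefficient contains \<open>br 0\<close>, and the other \<open>E j\<close>
  commutes with \<open>F i\<close>.\<close>

lemma F_pow_highest_eq_0:
  assumes "v \<in> wsp Lam" "\<And>i. E i v = 0"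
  shows "(F i ^^ Suc (nat (hub Lam i))) v = 0" (is "?u = 0")
proof (rule ccontr)
  assume "?u \<noteq> 0"
  have "E j ?u = 0" for j
  proof (cases "j = i")
    case True
    then show ?thesis
      using E_F_pow[OF assms(1), of i "nat (hub Lam i)"] dominant[of i] assms(2)
      by (simp only: F_pow_0) (simp add: br_eq_0_iff)
  next
    case False
    then show ?thesis using E_F_pow_neq[OF assms(1)] assms(2) by (simp only: F_pow_0) (metis F_pow_0)
  qed
  then have "Lam - int (Suc (nat (hub Lam i))) \<odot> simple_root i = Lam"
    using singular_weight F_pow_wsp[OF assms(1)] \<open>?u \<noteq> 0\<close> by blast
  then have "hub (Lam - int (Suc (nat (hub Lam i))) \<odot> simple_root i) i = hub Lam i" by simp
  then show False using dominant[of i] by simp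
qed

lemma F_pow_eq_0_mono: "(F i ^^ n) v = 0 \<Longrightarrow> n \<le> m \<Longrightarrow> (F i ^^ m) v = 0"
  by (metis F_pow_0 comp_apply funpow_add le_add_diff_inverse2)

text \<open>The Serre relation pushes \<open>F j\<close> to the left until at most two
  \<open>F i\<close> precede it, so at least \<open>n\<close> copies of \<open>F i\<close> act on
  \<open>v\<close> first. Only the shape of the relation enters, which is why its coefficients are
  existential.\<close>

lemma F_pow_F_eq_0:
  assumes "i \<noteq> j" "(F i ^^ n) v = 0"
  shows "(F i ^^ (n + 2)) (F j v) = 0"
proof -
  obtain a b c where serre: "\<And>v. F i (F i (F i (F j v))) =
      scale a (F i (F i (F j (F i v)))) + scale b (F i (F j (F i (F i v)))) +
      scale c (F j (F i (F i (F i v))))"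
    using Serre[OF assms(1)] by blast
  have expand: "\<exists>x y z. \<forall>v. (F i ^^ (m + 2)) (F j v) = scale x (F i (F i (F j ((F i ^^ m) v))))
      + scale y (F i (F j ((F i ^^ (m + 1)) v))) + scale z (F j ((F i ^^ (m + 2)) v))" for m
  proof (induction m)
    case 0
    show ?case by (intro exI[of _ 1] exI[of _ 0]) (simp add: numeral_2_eq_2)
  next
    case (Suc m)
    then obtain x y z where IH: "\<And>v. (F i ^^ (m + 2)) (F j v) =
      scale x (F i (F i (F j ((F i ^^ m) v))))
      + scale y (F i (F j ((F i ^^ (m + 1)) v))) + scale z (F j ((F i ^^ (m + 2)) v))" by blast
    have "(F i ^^ (Suc m + 2)) (F j v) = scale (x * a + y) (F i (F i (F j ((F i ^^ Suc m) v))))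
      + scale (x * b + z) (F i (F j ((F i ^^ (Suc m + 1)) v)))
      + scale (x * c) (F j ((F i ^^ (Suc m + 2)) v))" for v
    proof -
      have "(F i ^^ (Suc m + 2)) (F j v) = F i ((F i ^^ (m + 2)) (F j v))" by simp
      then show ?thesis unfolding IH
        by (simp add: F_add F_scale serre scale_right_distrib scale_left_distrib algebra_simps)
    qed
    then show ?case by blast
  qed
  show ?thesis using expand[of n] assms(2) F_pow_eq_0_mono[OF assms(2)] by (auto simp: F_0)
qed

lemma F_locally_nilpotent: "\<exists>n. (F i ^^ n) v = 0"
proof -
  obtain u where u: "u \<in> wsp Lam" "u \<noteq> 0" "\<And>i. E i u = 0" using highest_weight by blast
  have word: "\<exists>n. (F i ^^ n) w = 0" if "w \<in> F_words u" for w
    using that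
  proof (induction rule: F_words.induct)
    case F_words_base show ?case using F_pow_highest_eq_0[OF u(1,3)] by blast
  next
    case (F_words_step w j)
    then obtain n where n: "(F i ^^ n) w = 0" by blast
    show ?case
    proof (cases "i = j")
      case True
      have "(F i ^^ n) (F i w) = F i ((F i ^^ n) w)" by (simp add: funpow_swap1)
      then show ?thesis using n True F_0 by metis
    next
      case False
      then show ?thesis using F_pow_F_eq_0 n by blast
    qed
  qed
  have "v \<in> span (F_words u)" using span_F_words[OF u] by simp
  then show ?thesis
  proof (induction rule: span_induct_alt)
    case base show ?case by (rule exI[of _ 0]) simp
  next
    case (step c x y)
    then obtain n m where "(F i ^^ n) x = 0" "(F i ^^ m) y = 0" using word by blast
    then have "(F i ^^ (max n m)) (scale c x + y) = 0"
      using F_pow_eq_0_mono by (simp add: F_pow_add F_pow_scale)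
    then show ?case by blast
  qed
qed

lemma E_locally_nilpotent:
  assumes "v \<in> wsp lam"
  shows "\<exists>n. (E i ^^ n) v = 0"
proof -
  obtain n where "lam + int n \<odot> simple_root i \<notin> below Lam" using eventually_not_below by blast
  then show ?thesis using E_pow_wsp[OF assms] weights_below_Lam weightsI by metis
qed

lemma span_wsp: "span (\<Union>lam. wsp lam) = UNIV"
proof -
  obtain u where u: "u \<in> wsp Lam" "u \<noteq> 0" "\<And>i. E i u = 0" using highest_weight by blast
  have "F_words u \<subseteq> (\<Union>lam. wsp lam)" using F_words_wsp[OF _ u(1)] by blast
  then show ?thesis using span_F_words[OF u] span_mono by blast
qed

section \<open>Strings for the sl_2 attached to a node\<close>

lemma E_F_pow_singular:
  assumes "u \<in> wsp mu" "E i u = 0"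
  shows "E i ((F i ^^ Suc n) u) = scale (br (int n + 1) * br (hub mu i - int n)) ((F i ^^ n) u)"
  using E_F_pow[OF assms(1), of i n] assms(2) by (simp only: F_pow_0 add_0_left)

text \<open>The scalar is the product of \<open>br (k + 1) * br (hub mu i - k)\<close> over
  \<open>m \<le> k < n + m\<close>; no factor vanishes while \<open>k < hub mu i\<close>.\<close>

lemma E_pow_F_pow_singular:
  assumes "u \<in> wsp mu" "E i u = 0"
  shows "\<exists>c. (int (n + m) \<le> hub mu i \<longrightarrow> c \<noteq> 0) \<and> (E i ^^ n) ((F i ^^ (n + m)) u) = scale c ((F i ^^ m) u)"
proof (induction n)
  case 0
  show ?case by (rule exI[of _ 1]) simp
next
  case (Suc n)
  then obtain c where c: "int (n + m) \<le> hub mu i \<longrightarrow> c \<noteq> 0"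
    "(E i ^^ n) ((F i ^^ (n + m)) u) = scale c ((F i ^^ m) u)" by blast
  let ?d = "br (int (n + m) + 1) * br (hub mu i - int (n + m))"
  have "(E i ^^ Suc n) ((F i ^^ (Suc n + m)) u) = (E i ^^ n) (E i ((F i ^^ Suc (n + m)) u))"
    by (simp add: funpow_swap1)
  also have "\<dots> = scale (?d * c) ((F i ^^ m) u)"
    unfolding E_F_pow_singular[OF assms] by (simp only: E_pow_scale c(2) scale_scale)
  finally show ?case using c(1) by (intro exI[of _ "?d * c"]) (auto simp: br_eq_0_iff)
qed

lemma F_pow_singular_neq_0:
  assumes "u \<in> wsp mu" "E i u = 0" "u \<noteq> 0" "int n \<le> hub mu i"
  shows "(F i ^^ n) u \<noteq> 0"
  using E_pow_F_pow_singular[OF assms(1,2), of n 0] assms(3,4) by (auto simp: E_pow_0)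

text \<open>Beyond the length of the string the coefficients are nonzero again, so one nonzero power
  would make all later ones nonzero, against local nilpotency. The case \<open>n = 0\<close> rules
  out nonzero singular vectors of negative hub.\<close>

lemma F_pow_singular_eq_0:
  assumes "u \<in> wsp mu" "E i u = 0" "hub mu i < int n"
  shows "(F i ^^ n) u = 0"
proof (rule ccontr)
  assume "(F i ^^ n) u \<noteq> 0"
  then have "(F i ^^ (n + k)) u \<noteq> 0" for k
  proof (induction k)
    case (Suc k)
    have "scale (br (int (n + k) + 1) * br (hub mu i - int (n + k))) ((F i ^^ (n + k)) u) \<noteq> 0"
      using Suc assms(3) by (auto simp: br_eq_0_iff)
    then show ?case using E_F_pow_singular[OF assms(1,2), of "n + k"] E_0[of i] by auto
  qed simp
  then show False using F_locally_nilpotent[of i u] F_pow_eq_0_mono le_add2 by metis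
qed

text \<open>The term with \<open>F i (E i v)\<close> drops out of \<open>E_F_pow\<close>, and for
  negative hub the remaining coefficient never vanishes; hence no power of \<open>F i\<close> could
  kill a nonzero \<open>v\<close>.\<close>

lemma F_E_eq_0:
  assumes "v \<in> wsp lam" "F i (E i v) = 0" "hub lam i < 0"
  shows "v = 0"
proof (rule ccontr)
  assume "v \<noteq> 0"
  have "(F i ^^ k) v \<noteq> 0" for k
  proof (induction k)
    case 0 then show ?case using \<open>v \<noteq> 0\<close> by simp
  next
    case (Suc k)
    have "(F i ^^ Suc k) (E i v) = (F i ^^ k) (F i (E i v))" by (simp add: funpow_swap1)
    then have "E i ((F i ^^ Suc k) v) = scale (br (int k + 1) * br (hub lam i - int k)) ((F i ^^ k) v)"
      unfolding E_F_pow[OF assms(1)] using assms(2) by (simp only: F_pow_0 add_0_left)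
    moreover have "\<dots> \<noteq> 0" using Suc assms(3) by (simp add: br_eq_0_iff)
    ultimately show ?case using E_0[of i] by metis
  qed
  then show False using F_locally_nilpotent[of i v] by blast
qed

text \<open>\<open>hub lam i + 2 * int n\<close> is the hub of \<open>u\<close>, that is, the length
  of its string.\<close>

definition strings :: "node \<Rightarrow> weight \<Rightarrow> 'v set" where
  "strings i lam = {(F i ^^ n) u | n u. u \<in> wsp (lam + int n \<odot> simple_root i) \<and> E i u = 0 \<and>
     int n \<le> hub lam i + 2 * int n}"

text \<open>A preimage under \<open>E\<close> exists except for lowest vectors of a string, which \<open>F\<close> annihilates.\<close>

lemma strings_E_preimage:
  assumes "y \<in> span (strings i (lam + simple_root i))"
  shows "\<exists>w\<in>span (strings i lam). F i (y - E i w) = 0 \<and> (0 \<le> hub lam i \<longrightarrow> y = E i w)"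
  using assms
proof (induction rule: span_induct_alt)
  case base
  show ?case by (rule bexI[of _ 0]) (simp_all add: E_0 F_0 span_zero)
next
  case (step c x y)
  from step(2) obtain w where w: "w \<in> span (strings i lam)" "F i (y - E i w) = 0"
    "0 \<le> hub lam i \<longrightarrow> y = E i w" by blast
  from step(1) obtain n u where u: "x = (F i ^^ n) u" "E i u = 0"
    "u \<in> wsp (lam + simple_root i + int n \<odot> simple_root i)" "int n \<le> hub lam i + 2 + 2 * int n"
    unfolding strings_def by auto
  have weight: "lam + simple_root i + int n \<odot> simple_root i = lam + int (Suc n) \<odot> simple_root i"
    by (rule weight_eqI) (simp_all add: algebra_simps)
  have hub: "hub (lam + int (Suc n) \<odot> simple_root i) i = hub lam i + 2 * int n + 2" by simp
  show ?case
  proof (cases "int n = hub lam i + 2 + 2 * int n")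
    \<comment> \<open>Here \<open>x\<close> is the lowest vector of its string and
      \<open>hub lam i = - 2 - int n\<close> is negative, so \<open>w\<close> can be kept.\<close>
    case True
    have "(F i ^^ Suc n) u = 0"
      by (rule F_pow_singular_eq_0[OF u(3)[unfolded weight] u(2)]) (use True hub in simp)
    then have "F i x = 0" using u(1) by simp
    then show ?thesis using w True
      by (intro bexI[OF _ w(1)]) (simp add: F_add F_diff F_scale)
  next
    case False
    let ?d = "br (int n + 1) * br (hub lam i + 2 * int n + 2 - int n)"
    define z where "z = scale (1 / ?d) ((F i ^^ Suc n) u)"
    have d: "?d \<noteq> 0" using False by (auto simp: br_eq_0_iff)
    have Ez: "E i z = x"
      using E_F_pow_singular[OF u(3)[unfolded weight] u(2), of n] d u(1)
      by (simp only: z_def E_scale hub scale_scale) simp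
    have "(F i ^^ Suc n) u \<in> strings i lam"
      unfolding strings_def using u False weight by (intro CollectI exI[of _ "Suc n"] exI[of _ u]) auto
    then have "z \<in> span (strings i lam)" unfolding z_def by (intro span_scale span_base)
    then have "scale c z + w \<in> span (strings i lam)" using w(1) by (intro span_add span_scale)
    then show ?thesis using w(2,3) by (intro bexI[of _ "scale c z + w"]) (simp_all add: E_add E_scale Ez)
  qed
qed

lemma strings_wsp: "span (strings i lam) \<subseteq> wsp lam"
proof (rule span_minimal[OF _ subspace_wsp], rule subsetI)
  fix x assume "x \<in> strings i lam"
  then obtain n u where u: "x = (F i ^^ n) u" "u \<in> wsp (lam + int n \<odot> simple_root i)"
    unfolding strings_def by auto
  have "lam + int n \<odot> simple_root i - int n \<odot> simple_root i = lam" by simp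
  then show "x \<in> wsp lam" using F_pow_wsp[OF u(2), of n i] u(1) by simp
qed

text \<open>Induction on the power of \<open>E i\<close> killing \<open>v\<close>:
  \<open>E i v\<close> decomposes, and a combination \<open>w\<close> of strings is subtracted. If
  the hub is nonnegative, \<open>v - w\<close> is singular and is itself a string with
  \<open>n = 0\<close>; if negative, \<open>F_E_eq_0\<close> gives \<open>v = w\<close>.\<close>

lemma wsp_eq_span_strings: "wsp lam = span (strings i lam)"
proof
  have "v \<in> span (strings i lam)" if "(E i ^^ p) v = 0" "v \<in> wsp lam" for p v lam
    using that
  proof (induction p arbitrary: v lam)
    case 0
    then show ?case by (simp add: span_zero)
  next
    case (Suc p)
    have "E i v \<in> span (strings i (lam + simple_root i))"
      using Suc by (intro Suc.IH E_wsp) (simp_all add: funpow_swap1)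
    then obtain w where w: "w \<in> span (strings i lam)" "F i (E i v - E i w) = 0"
      "0 \<le> hub lam i \<longrightarrow> E i v = E i w"
      using strings_E_preimage by blast
    have vw: "v - w \<in> wsp lam" using w(1) Suc.prems(2) strings_wsp subspace_diff[OF subspace_wsp] by blast
    have "v - w \<in> span (strings i lam)"
    proof (cases "0 \<le> hub lam i")
      case True
      then have "v - w \<in> strings i lam" unfolding strings_def
        using vw w(3) by (intro CollectI exI[of _ 0] exI[of _ "v - w"]) (simp add: E_diff weight_scale_simps)
      then show ?thesis by (rule span_base)
    next
      case False
      then have "v - w = 0" using F_E_eq_0[OF vw] w(2) by (simp add: E_diff)
      then show ?thesis by (simp add: span_zero)
    qed
    then show ?case using span_add[OF _ w(1)] by fastforce
  qed
  then show "wsp lam \<subseteq> span (strings i lam)" using E_locally_nilpotent by blast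
qed (rule strings_wsp)

lemma weights_stringE:
  assumes "lam \<in> weights"
  obtains n where "0 \<le> hub lam i + int n"
    "\<And>m. m \<le> nat (hub lam i + 2 * int n) \<Longrightarrow> lam + (int n - int m) \<odot> simple_root i \<in> weights"
proof -
  have "\<not> strings i lam \<subseteq> {0}"
    using assms wsp_eq_span_strings[of lam i] span_mono[of "strings i lam" "{0}"]
    unfolding weights_def by (auto simp: span_zero)
  then obtain n u where u: "(F i ^^ n) u \<noteq> 0" "u \<in> wsp (lam + int n \<odot> simple_root i)" "E i u = 0"
     "int n \<le> hub lam i + 2 * int n"
    unfolding strings_def by blast
  then have "u \<noteq> 0" using F_pow_0 by metis
  have "lam + (int n - int m) \<odot> simple_root i \<in> weights" if "m \<le> nat (hub lam i + 2 * int n)" for m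
  proof -
    have "lam + int n \<odot> simple_root i - int m \<odot> simple_root i = lam + (int n - int m) \<odot> simple_root i"
      by (rule weight_eqI) (simp_all add: algebra_simps)
    moreover have "(F i ^^ m) u \<noteq> 0"
      using F_pow_singular_neq_0[OF u(2,3) \<open>u \<noteq> 0\<close>] u(4) that by simp
    ultimately show ?thesis using F_pow_wsp[OF u(2), of m i] weightsI by metis
  qed
  then show thesis by (intro that[of n]) (use u(4) in simp)
qed

section \<open>Weyl reflections and nonnegative defect\<close>

lemma reflection_weights:
  assumes "lam \<in> weights"
  shows "lam - hub lam i \<odot> simple_root i \<in> weights"
proof -
  obtain n where n: "0 \<le> hub lam i + int n"
    "\<And>m. m \<le> nat (hub lam i + 2 * int n) \<Longrightarrow> lam + (int n - int m) \<odot> simple_root i \<in> weights"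
    using weights_stringE[OF assms] by metis
  \<comment> \<open>In a string of length \<open>hub lam i + 2 * int n\<close>, the mirror image of
    position \<open>n\<close> is \<open>hub lam i + int n\<close>.\<close>
  have "lam + (int n - int (nat (hub lam i + int n))) \<odot> simple_root i \<in> weights"
    by (rule n(2)) simp
  moreover have "lam + (int n - int (nat (hub lam i + int n))) \<odot> simple_root i = lam - hub lam i \<odot> simple_root i"
    using n(1) by (intro weight_eqI) (simp_all add: algebra_simps)
  ultimately show ?thesis by simp
qed

lemma form_reflection:
  "form (lam - hub lam i \<odot> simple_root i) (lam - hub lam i \<odot> simple_root i) = form lam lam"
  by (simp add: form_diff_left form_diff_right form_scale_left form_scale_right
      form_sym[of "simple_root i"] form_simple_root_hub algebra_simps)

text \<open>A negative hub allows a reflection, which keeps the norm and lowers the degree. Once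
  \<open>lam = Lam - c\<close> is dominant, the norm difference is
  \<open>form (lam + Lam) c\<close>, and dominant weights pair nonnegatively with sums of simple
  roots.\<close>

lemma defect_nonneg:
  assumes "lam \<in> weights"
  shows "0 \<le> defect Lam lam"
proof -
  have le: "form lam lam \<le> form Lam Lam"
    if "lam \<in> weights" "lam = Lam - (int c0 \<odot> simple_root Node0 + int c1 \<odot> simple_root Node1)"
    for c0 c1 :: nat and lam
    using that
  proof (induction "c0 + c1" arbitrary: c0 c1 lam rule: less_induct)
    case less
    show ?case
    proof (cases "\<exists>i. hub lam i < 0")
      case True
      then obtain i where i: "hub lam i < 0" by blast
      let ?lam = "lam - hub lam i \<odot> simple_root i"
      have mem: "?lam \<in> weights" using less.prems(1) by (rule reflection_weights)
      then obtain d0 d1 :: nat where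
        d: "?lam = Lam - (int d0 \<odot> simple_root Node0 + int d1 \<odot> simple_root Node1)"
        using weights_below_Lam unfolding below_def by blast
      define h where "h = hub lam i"
      have "int d0 + int d1 = int c0 + int c1 + h"
        using d[folded h_def] less.prems(2) by (cases i) (auto simp: prod_eq_iff null_root_def)
      then show ?thesis
        using less.hyps[OF _ mem d] i form_reflection[of lam i] by (simp add: h_def)
    next
      case False
      define c where "c = int c0 \<odot> simple_root Node0 + int c1 \<odot> simple_root Node1"
      have Lam: "Lam = lam + c" unfolding less.prems(2) c_def by simp
      have "form Lam Lam - form lam lam = form lam c + form Lam c"
        unfolding Lam by (simp add: form_add_left form_add_right form_sym[of c lam])
      also have "\<dots> = of_int (int c0 * (hub lam Node0 + hub Lam Node0)
          + int c1 * (hub lam Node1 + hub Lam Node1))"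
        by (simp only: c_def form_add_right form_scale_right form_simple_root_hub)
          (simp add: algebra_simps)
      also have "\<dots> \<ge> 0"
        using False dominant unfolding of_int_0_le_iff
        by (intro add_nonneg_nonneg mult_nonneg_nonneg) (auto simp: not_less)
      finally show ?thesis by simp
    qed
  qed
  obtain c0 c1 :: nat where "lam = Lam - (int c0 \<odot> simple_root Node0 + int c1 \<odot> simple_root Node1)"
    using weights_below_Lam[OF assms] unfolding below_def by blast
  then show ?thesis using le[OF assms] unfolding defect_def by simp
qed

section \<open>Operators prescribed on strings\<close>

definition F_fact :: "nat \<Rightarrow> 'k" where
  "F_fact n = (\<Prod>k=1..n. br (int k))"

definition F_div :: "node \<Rightarrow> nat \<Rightarrow> 'v \<Rightarrow> 'v" where
  "F_div i n v = scale (1 / F_fact n) ((F i ^^ n) v)"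

lemma F_fact_neq_0: "F_fact n \<noteq> 0"
  unfolding F_fact_def by (simp add: br_eq_0_iff)

lemma F_div_0 [simp]: "F_div i 0 v = v"
  by (simp add: F_div_def F_fact_def)

lemma linear_F_div: "Vector_Spaces.linear scale scale (F_div i n)"
  by (rule linear_endoI) (simp_all add: F_div_def F_pow_add F_pow_scale scale_right_distrib mult.commute)

text \<open>The component of a family at \<open>(lam, n)\<close> is the highest weight vector \<open>u\<close>, of weight \<open>lam\<close>, of a
  term \<open>F_div i n u\<close> in a string decomposition.\<close>

definition families :: "node \<Rightarrow> (weight \<times> nat \<Rightarrow> 'v) set" where
  "families i = {u. finite {k. u k \<noteq> 0} \<and> (\<forall>k. u k \<in> wsp (fst k) \<and> E i (u k) = 0 \<and>
     (u k \<noteq> 0 \<longrightarrow> int (snd k) \<le> hub (fst k) i))}"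

lemma familiesD:
  assumes "u \<in> families i"
  shows "u k \<in> wsp (fst k)" "E i (u k) = 0" "u k \<noteq> 0 \<Longrightarrow> int (snd k) \<le> hub (fst k) i"
  using assms unfolding families_def by blast+

text \<open>With \<open>F_div i\<close> for \<open>A\<close> this recombines a decomposed vector;
  with another \<open>A\<close> it evaluates the operator prescribed by \<open>A\<close> on that
  vector.\<close>

definition assemble :: "(nat \<Rightarrow> 'v \<Rightarrow> 'v) \<Rightarrow> (weight \<times> nat \<Rightarrow> 'v) \<Rightarrow> 'v" where
  "assemble A u = (\<Sum>k | u k \<noteq> 0. A (snd k) (u k))"

lemma assemble_superset:
  assumes "\<And>n. Vector_Spaces.linear scale scale (A n)" "finite K" "{k. u k \<noteq> 0} \<subseteq> K"
  shows "assemble A u = (\<Sum>k\<in>K. A (snd k) (u k))"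
proof -
  have "A n 0 = 0" for n
    using module_hom.zero[OF Vector_Spaces.linear.axioms(3)[OF assms(1)]] .
  then show ?thesis unfolding assemble_def
    by (intro sum.mono_neutral_left) (use assms(2,3) in auto)
qed

lemma assemble_add:
  assumes A: "\<And>n. Vector_Spaces.linear scale scale (A n)" and "u \<in> families i" "w \<in> families i"
  shows "assemble A (\<lambda>k. u k + w k) = assemble A u + assemble A w"
proof -
  let ?K = "{k. u k \<noteq> 0} \<union> {k. w k \<noteq> 0}"
  have fin: "finite ?K" using assms unfolding families_def by auto
  have "assemble A (\<lambda>k. u k + w k) = (\<Sum>k\<in>?K. A (snd k) (u k + w k))"
    by (rule assemble_superset[OF A fin]) auto
  also have "\<dots> = (\<Sum>k\<in>?K. A (snd k) (u k)) + (\<Sum>k\<in>?K. A (snd k) (w k))"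
    by (simp only: module_hom.add[OF Vector_Spaces.linear.axioms(3)[OF A]] sum.distrib)
  also have "\<dots> = assemble A u + assemble A w"
    using assemble_superset[OF A fin, of u] assemble_superset[OF A fin, of w] by auto
  finally show ?thesis .
qed

lemma assemble_scale:
  assumes A: "\<And>n. Vector_Spaces.linear scale scale (A n)" and "u \<in> families i"
  shows "assemble A (\<lambda>k. scale c (u k)) = scale c (assemble A u)"
proof -
  have "assemble A (\<lambda>k. scale c (u k)) = (\<Sum>k | u k \<noteq> 0. A (snd k) (scale c (u k)))"
    by (rule assemble_superset[OF A]) (use assms in \<open>auto simp: families_def\<close>)
  also have "\<dots> = scale c (assemble A u)"
    unfolding assemble_def
    by (simp only: module_hom.scale[OF Vector_Spaces.linear.axioms(3)[OF A]] scale_sum_right)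
  finally show ?thesis .
qed

lemma families_add: "u \<in> families i \<Longrightarrow> w \<in> families i \<Longrightarrow> (\<lambda>k. u k + w k) \<in> families i"
proof -
  assume u: "u \<in> families i" and w: "w \<in> families i"
  have "finite {k. u k + w k \<noteq> 0}"
    by (rule finite_subset[of _ "{k. u k \<noteq> 0} \<union> {k. w k \<noteq> 0}"]) (use u w in \<open>auto simp: families_def\<close>)
  moreover have "u k + w k \<in> wsp (fst k)" "E i (u k + w k) = 0" for k
    using u w unfolding families_def by (simp_all add: subspace_add[OF subspace_wsp] E_add)
  moreover have "int (snd k) \<le> hub (fst k) i" if "u k + w k \<noteq> 0" for k
  proof -
    have "u k \<noteq> 0 \<or> w k \<noteq> 0" using that by force
    then show ?thesis using u w unfolding families_def by blast
  qed
  ultimately show ?thesis unfolding families_def by blast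
qed

lemma families_scale: "u \<in> families i \<Longrightarrow> (\<lambda>k. scale c (u k)) \<in> families i"
proof -
  assume u: "u \<in> families i"
  have "finite {k. scale c (u k) \<noteq> 0}"
    by (rule finite_subset[of _ "{k. u k \<noteq> 0}"]) (use u in \<open>auto simp: families_def\<close>)
  moreover have "scale c (u k) \<in> wsp (fst k)" "E i (scale c (u k)) = 0" for k
    using u unfolding families_def by (simp_all add: subspace_scale[OF subspace_wsp] E_scale)
  moreover have "int (snd k) \<le> hub (fst k) i" if "scale c (u k) \<noteq> 0" for k
    using u that unfolding families_def by force
  ultimately show ?thesis unfolding families_def by blast
qed

text \<open>Apply \<open>E\<close> as often as the longest string occurring in the family demands: only the top terms
  survive, and they have different weights.\<close>

lemma assemble_F_div_eq_0:
  assumes u: "u \<in> families i" and zero: "assemble (F_div i) u = 0"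
  shows "u k = 0"
proof (rule ccontr)
  assume "u k \<noteq> 0"
  define S where "S = {k. u k \<noteq> 0}"
  define N where "N = Max (snd ` S)"
  define A where "A = {lam. (lam, N) \<in> S}"
  have fin: "finite S" using u unfolding families_def S_def by blast
  have "S \<noteq> {}" using \<open>u k \<noteq> 0\<close> S_def by blast
  then have "N \<in> snd ` S" using fin unfolding N_def by (intro Max_in) auto
  then obtain lam where lam: "(lam, N) \<in> S" by auto
  have wsp: "u (mu, n) \<in> wsp mu" "E i (u (mu, n)) = 0" for mu n
    using familiesD(1,2)[OF u, of "(mu, n)"] by simp_all
  have finA: "finite A"
    by (rule finite_subset[of _ "fst ` S"]) (use fin in \<open>force simp: A_def\<close>)+
  \<comment> \<open>After \<open>n\<close> steps a multiple of the singular vector is reached, and a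
    further \<open>E i\<close> kills it.\<close>
  have low: "(E i ^^ N) (F_div i n (u (mu, n))) = 0" if "(mu, n) \<in> S" "n \<noteq> N" for mu n
  proof -
    have "n \<in> snd ` S" using that(1) by force
    then have "n < N" using fin that(2) unfolding N_def by (simp add: order.not_eq_order_implies_strict)
    then obtain m where m: "N = Suc m + n" using less_iff_Suc_add by (metis add.commute add_Suc_right)
    have "(E i ^^ N) ((F i ^^ n) (u (mu, n))) = (E i ^^ Suc m) ((E i ^^ n) ((F i ^^ (n + 0)) (u (mu, n))))"
      unfolding m funpow_add by simp
    also obtain c where "(E i ^^ n) ((F i ^^ (n + 0)) (u (mu, n))) = scale c ((F i ^^ 0) (u (mu, n)))"
      using E_pow_F_pow_singular[OF wsp] by blast
    also have "(E i ^^ Suc m) (scale c ((F i ^^ 0) (u (mu, n)))) = 0"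
      using wsp(2) by (simp add: funpow_Suc_right E_scale E_pow_0 del: funpow.simps)
    finally show ?thesis by (simp add: F_div_def E_pow_scale)
  qed
  have top: "(E i ^^ N) (F_div i N (u (mu, N))) \<in> wsp mu" for mu
  proof -
    have "(E i ^^ N) ((F i ^^ N) (u (mu, N))) \<in> wsp (mu - int N \<odot> simple_root i + int N \<odot> simple_root i)"
      by (intro E_pow_wsp F_pow_wsp wsp)
    then show ?thesis by (simp add: F_div_def E_pow_scale subspace_scale[OF subspace_wsp])
  qed
  have "0 = (E i ^^ N) (\<Sum>k\<in>S. F_div i (snd k) (u k))"
    using zero unfolding assemble_def S_def by (simp add: E_pow_0)
  also have "\<dots> = (\<Sum>k\<in>S. (E i ^^ N) (F_div i (snd k) (u k)))" by (rule E_pow_sum)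
  also have "\<dots> = (\<Sum>k\<in>(\<lambda>mu. (mu, N)) ` A. (E i ^^ N) (F_div i (snd k) (u k)))"
  proof (rule sum.mono_neutral_right[OF fin])
    show "\<forall>k\<in>S - (\<lambda>mu. (mu, N)) ` A. (E i ^^ N) (F_div i (snd k) (u k)) = 0"
    proof
      fix k assume k: "k \<in> S - (\<lambda>mu. (mu, N)) ` A"
      obtain mu n where mu: "k = (mu, n)" by (rule prod.exhaust)
      then have "n \<noteq> N" using k unfolding A_def by blast
      then show "(E i ^^ N) (F_div i (snd k) (u k)) = 0" using low[of mu n] k mu by simp
    qed
  qed (auto simp: A_def)
  also have "\<dots> = (\<Sum>mu\<in>A. (E i ^^ N) (F_div i N (u (mu, N))))"
    by (subst sum.reindex) (auto simp: inj_on_def)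
  finally have "(E i ^^ N) (F_div i N (u (lam, N))) = 0"
    using finA top lam by (intro wsp_sum_eq_0[of A "\<lambda>mu. (E i ^^ N) (F_div i N (u (mu, N)))" lam])
      (auto simp: A_def)
  then have "(E i ^^ N) ((F i ^^ (N + 0)) (u (lam, N))) = 0"
    using F_fact_neq_0 by (simp add: F_div_def E_pow_scale)
  moreover have "u (lam, N) \<noteq> 0" using lam by (simp add: S_def)
  moreover from this have "int N \<le> hub lam i" using familiesD(3)[OF u, of "(lam, N)"] by simp
  ultimately show False
    using E_pow_F_pow_singular[OF wsp, of N 0 lam N] by auto
qed

lemma families_single:
  assumes "u \<in> wsp lam" "E i u = 0" "int n \<le> hub lam i"
  shows "(\<lambda>k. if k = (lam, n) then u else 0) \<in> families i"
  using assms unfolding families_def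
  by (auto intro: finite_subset[of _ "{(lam, n)}"] simp: E_0 subspace_0[OF subspace_wsp])

lemma assemble_single:
  assumes "\<And>n. Vector_Spaces.linear scale scale (A n)"
  shows "assemble A (\<lambda>k. if k = (lam, n) then u else 0) = A n u"
proof -
  have "assemble A (\<lambda>k. if k = (lam, n) then u else 0)
      = (\<Sum>k\<in>{(lam, n)}. A (snd k) (if k = (lam, n) then u else 0))"
    by (rule assemble_superset[OF assms]) auto
  then show ?thesis by simp
qed

lemma span_strings_F_div:
  "span {F_div i n u | lam n u. u \<in> wsp lam \<and> E i u = 0 \<and> int n \<le> hub lam i} = UNIV"
  (is "span ?X = UNIV")
proof -
  have "strings i lam \<subseteq> span ?X" for lam
  proof
    fix x assume "x \<in> strings i lam"
    then obtain n u where u: "x = (F i ^^ n) u" "u \<in> wsp (lam + int n \<odot> simple_root i)" "E i u = 0"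
      "int n \<le> hub lam i + 2 * int n" unfolding strings_def by blast
    then have "F_div i n u \<in> ?X"
      by (intro CollectI exI[of _ "lam + int n \<odot> simple_root i"] exI[of _ n] exI[of _ u]) simp
    then have "scale (F_fact n) (F_div i n u) \<in> span ?X" by (intro span_scale span_base)
    then show "x \<in> span ?X" using u(1) F_fact_neq_0 by (simp add: F_div_def)
  qed
  then have "wsp lam \<subseteq> span ?X" for lam
    using wsp_eq_span_strings[of lam i] span_minimal[OF _ subspace_span] by blast
  then have "span (\<Union>lam. wsp lam) \<subseteq> span ?X"
    by (intro span_minimal[OF _ subspace_span]) blast
  then show ?thesis using span_wsp by blast
qed

lemma assemble_surj: "\<exists>u\<in>families i. v = assemble (F_div i) u"
proof -
  have "v \<in> span {F_div i n u | lam n u. u \<in> wsp lam \<and> E i u = 0 \<and> int n \<le> hub lam i}"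
    using span_strings_F_div by simp
  then show ?thesis
  proof (induction rule: span_induct_alt)
    case base
    show ?case
      by (rule bexI[of _ "\<lambda>_. 0"]) (auto simp: assemble_def families_def E_0 subspace_0[OF subspace_wsp])
  next
    case (step c x y)
    from step(1) obtain lam n u where u: "x = F_div i n u" "u \<in> wsp lam" "E i u = 0"
      "int n \<le> hub lam i" by blast
    let ?u = "\<lambda>k. if k = (lam, n) then u else 0"
    from step(2) obtain w where w: "w \<in> families i" "y = assemble (F_div i) w" by blast
    note fam = families_single[OF u(2-4)]
    have "scale c x + y = assemble (F_div i) (\<lambda>k. scale c (?u k) + w k)"
      using assemble_add[where A = "F_div i", OF linear_F_div families_scale[OF fam] w(1), of c]
        assemble_scale[where A = "F_div i", OF linear_F_div fam, of c] assemble_single[where A = "F_div i", OF linear_F_div, of lam n u]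
        w(2) u(1) by simp
    then show ?case using families_add[OF families_scale[OF fam] w(1)] by blast
  qed
qed

text \<open>This validates the descriptions of the Kashiwara operators. The decomposition
  \<open>c v\<close> is chosen arbitrarily, but its uniqueness makes \<open>c\<close> linear; hence
  \<open>assemble A (c v)\<close> is linear in \<open>v\<close>. Uniqueness holds because the terms
  \<open>F_div i n u\<close> span.\<close>

lemma ex1_linear_on_strings:
  assumes A: "\<And>n. Vector_Spaces.linear scale scale (A n)"
  shows "\<exists>!g. Vector_Spaces.linear scale scale g \<and>
    (\<forall>lam u n. u \<in> wsp lam \<and> E i u = 0 \<and> int n \<le> hub lam i \<longrightarrow> g (F_div i n u) = A n u)"
proof (rule ex_ex1I)
  define c where "c v = (SOME u. u \<in> families i \<and> v = assemble (F_div i) u)" for v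
  have c: "c v \<in> families i" "v = assemble (F_div i) (c v)" for v
  proof -
    have "\<exists>u. u \<in> families i \<and> v = assemble (F_div i) u" using assemble_surj by blast
    then have "c v \<in> families i \<and> v = assemble (F_div i) (c v)" unfolding c_def by (rule someI_ex)
    then show "c v \<in> families i" "v = assemble (F_div i) (c v)" by blast+
  qed
  have c_eq: "c (assemble (F_div i) u) = u" if u: "u \<in> families i" for u
  proof
    fix k
    let ?w = "c (assemble (F_div i) u)"
    let ?d = "\<lambda>k. ?w k + scale (- 1) (u k)"
    have "assemble (F_div i) ?d = assemble (F_div i) ?w + scale (- 1) (assemble (F_div i) u)"
      by (simp only: assemble_add[where A = "F_div i", OF linear_F_div c(1) families_scale[OF u]]
          assemble_scale[where A = "F_div i", OF linear_F_div u])
    also have "\<dots> = 0" using c(2)[of "assemble (F_div i) u"] by simp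
    finally have "?d k = 0"
      by (intro assemble_F_div_eq_0[of ?d i] families_add c(1) families_scale u)
    then show "?w k = u k" by simp
  qed
  let ?g = "\<lambda>v. assemble A (c v)"
  have "c (x + y) = (\<lambda>k. c x k + c y k)" for x y
    using c_eq[OF families_add[OF c(1) c(1)]] assemble_add[where A = "F_div i", OF linear_F_div c(1) c(1)] c(2) by metis
  moreover have "c (scale r x) = (\<lambda>k. scale r (c x k))" for r x
    using c_eq[OF families_scale[OF c(1)]] assemble_scale[where A = "F_div i", OF linear_F_div c(1)] c(2) by metis
  ultimately have "Vector_Spaces.linear scale scale ?g"
    by (intro linear_endoI) (simp_all add: assemble_add[OF A c(1) c(1)] assemble_scale[OF A c(1)])
  moreover have "?g (F_div i n u) = A n u" if "u \<in> wsp lam" "E i u = 0" "int n \<le> hub lam i" for lam u n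
  proof -
    have "c (F_div i n u) = (\<lambda>k. if k = (lam, n) then u else 0)"
      using c_eq[OF families_single[OF that]]
      unfolding assemble_single[where A = "F_div i", OF linear_F_div] .
    then show ?thesis by (simp only: assemble_single[OF A])
  qed
  ultimately show "\<exists>g. Vector_Spaces.linear scale scale g \<and>
    (\<forall>lam u n. u \<in> wsp lam \<and> E i u = 0 \<and> int n \<le> hub lam i \<longrightarrow> g (F_div i n u) = A n u)"
    by blast
next
  fix g g'
  assume g: "Vector_Spaces.linear scale scale g \<and>
    (\<forall>lam u n. u \<in> wsp lam \<and> E i u = 0 \<and> int n \<le> hub lam i \<longrightarrow> g (F_div i n u) = A n u)"
    and g': "Vector_Spaces.linear scale scale g' \<and>
    (\<forall>lam u n. u \<in> wsp lam \<and> E i u = 0 \<and> int n \<le> hub lam i \<longrightarrow> g' (F_div i n u) = A n u)"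
  have "g v = g' v" for v
  proof -
    have "v \<in> span {F_div i n u | lam n u. u \<in> wsp lam \<and> E i u = 0 \<and> int n \<le> hub lam i}"
      using span_strings_F_div by simp
    then show ?thesis
    proof (induction rule: span_induct_alt)
      case base
      show ?case using g g' unfolding Vector_Spaces.linear_iff_module_hom
        by (metis module_hom.zero)
    next
      case (step r x y)
      then have "g x = g' x" using g g' by auto
      then show ?case using step g g' unfolding Vector_Spaces.linear_iff by simp
    qed
  qed
  then show "g = g'" by blast
qed

end

section \<open>The classical and the quantum instance\<close>

context affine_module
begin

lemma torus_module: "torus_module scale H of_int"
  by (intro torus_module.intro torus_module_axioms.intro vector_space_axioms linear_H) (simp add: inj_def)

lemma weight_space_eq_wsp: "weight_space lam = torus_module.wsp scale H of_int lam"
  by (simp add: weight_space_def torus_module.wsp_def[OF torus_module])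

lemmas F_diff = module_hom.diff[OF Vector_Spaces.linear.axioms(3)[OF linear_F]]
lemmas E_add = module_hom.add[OF Vector_Spaces.linear.axioms(3)[OF linear_E]]
lemmas F_add = module_hom.add[OF Vector_Spaces.linear.axioms(3)[OF linear_F]]
lemmas E_scale = module_hom.scale[OF Vector_Spaces.linear.axioms(3)[OF linear_E]]
lemmas F_scale = module_hom.scale[OF Vector_Spaces.linear.axioms(3)[OF linear_F]]

lemma H_E_apply: "H h (E i v) = E i (H h v) + scale (of_int (pairing (simple_root i) h)) (E i v)"
  using fun_cong[OF H_E[of h i], of v] by (simp add: commutator_def algebra_simps)

lemma H_F_apply: "H h (F i v) = F i (H h v) - scale (of_int (pairing (simple_root i) h)) (F i v)"
  using fun_cong[OF H_F[of h i], of v] by (simp add: commutator_def algebra_simps)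

lemma E_F_apply: "E i (F j v) = F j (E i v) + (if i = j then H (coroot i) v else 0)"
  using fun_cong[OF E_F[of i j], of v] by (cases "i = j") (simp_all add: commutator_def algebra_simps)

lemma Serre_F_apply:
  assumes "i \<noteq> j"
  shows "F i (F i (F i (F j v))) = scale 3 (F i (F i (F j (F i v)))) +
      scale (- 3) (F i (F j (F i (F i v)))) + scale 1 (F j (F i (F i (F i v))))"
proof -
  have "nat (1 - pairing (simple_root j) (coroot i)) = 3"
    using assms hub_simple_root[of j i] by (simp add: hub_def)
  then have "(commutator (F i) ^^ 3) (F j) v = 0" using Serre_F[OF assms] by simp
  moreover have "scale 3 x = x + x + x" for x
    using scale_left_distrib[of "1 + 1" 1 x] scale_left_distrib[of 1 1 x] by simp
  ultimately show ?thesis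
    by (simp add: numeral_3_eq_3 commutator_def F_diff F_add algebra_simps)
qed

lemma hw_module:
  assumes irr: "irreducible_highest_weight Lam" and dom: "\<And>i. 0 \<le> hub Lam i"
  shows "hw_module scale H of_int E F of_int Lam"
proof -
  interpret torus_module scale H of_int by (rule torus_module)
  have ws: "weight_space = wsp" using weight_space_eq_wsp by blast
  show ?thesis
  proof
    fix i j lam v
    show "E i v \<in> wsp (lam + simple_root i)" if "v \<in> wsp lam"
      using that by (auto simp: wsp_def H_E_apply E_scale pairing_add scale_left_distrib)
    show "F i v \<in> wsp (lam - simple_root i)" if "v \<in> wsp lam"
      using that by (auto simp: wsp_def H_F_apply F_scale pairing_diff scale_left_diff_distrib)
    show "E i (F j v) = F j (E i v) + (if i = j then scale (of_int (hub lam i)) v else 0)"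
      if "v \<in> wsp lam"
      using that by (simp add: E_F_apply hub_def wsp_T)
    show "\<exists>a b c. \<forall>v. F i (F i (F i (F j v))) =
      scale a (F i (F i (F j (F i v)))) + scale b (F i (F j (F i (F i v)))) +
      scale c (F j (F i (F i (F i v))))" if "i \<noteq> j"
      using Serre_F_apply[OF that] by blast
    show "\<exists>v\<in>wsp Lam. v \<noteq> 0 \<and> (\<forall>i. E i v = 0)"
      using irr ws unfolding irreducible_highest_weight_def by metis
    show "W = {0} \<or> W = UNIV" if "subspace W" "\<And>w i. w \<in> W \<Longrightarrow> E i w \<in> W"
      "\<And>w i. w \<in> W \<Longrightarrow> F i w \<in> W" "\<And>w h. w \<in> W \<Longrightarrow> H h w \<in> W" for W
      using irr that unfolding irreducible_highest_weight_def submodule_def by blast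
  qed (simp_all add: E_add E_scale F_add F_scale dom algebra_simps)
qed

end

text \<open>The extension of \<open>q_int\<close> to integers: hubs of weights may be
  negative.\<close>

definition q_br :: "int \<Rightarrow> qfield" where
  "q_br n = (q powi n - q powi (- n)) / (q - inverse q)"

lemma q_power: "q ^ n = Fract (monom 1 n) 1"
  by (induction n) (simp_all add: q_def One_fract_def monom_altdef flip: one_pCons)

lemma q_neq_0: "q \<noteq> 0"
  by (simp add: q_def Zero_fract_def eq_fract)

lemma q_power_eq_1_iff: "q ^ n = 1 \<longleftrightarrow> n = 0"
proof
  assume "q ^ n = 1"
  then have "monom (1 :: rat) n = 1"
    by (simp add: q_power One_fract_def eq_fract)
  then show "n = 0" by (metis degree_1 degree_monom_eq one_neq_zero)
qed simp

lemma inj_q_powi: "inj (\<lambda>n. q powi n)"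
proof (rule injI)
  have le: "m = n" if "q powi m = q powi n" "n \<le> m" for m n :: int
  proof -
    have "q powi (m - n) = 1" using that(1) q_neq_0 by (simp add: power_int_diff)
    then have "q ^ nat (m - n) = 1" using that(2) by (simp add: power_int_def)
    then show ?thesis using that(2) q_power_eq_1_iff by simp
  qed
  show "m = n" if "q powi m = q powi n" for m n :: int
    using le[of m n] le[of n m] that by linarith
qed

lemma q_diff_neq_0: "q - inverse q \<noteq> 0"
  using injD[OF inj_q_powi, of 1 "- 1"] by (auto simp: power_int_minus)

lemma q_br_eq_0_iff: "q_br n = 0 \<longleftrightarrow> n = 0"
  using injD[OF inj_q_powi, of n "- n"] q_diff_neq_0 by (auto simp: q_br_def)

lemma q_br_shift: "q_br (a + 1) * q_br b = q_br a * q_br (b + 1) + q_br (b - a)"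
proof -
  define D where "D = q - inverse q"
  have D: "D \<noteq> 0" using q_diff_neq_0 D_def by simp
  have br: "q_br n = (q powi n - inverse (q powi n)) / D" for n
    by (simp add: q_br_def D_def power_int_minus)
  \<comment> \<open>Independent variables replace the powers of \<open>q\<close> and their inverses,
    which leaves a polynomial identity in them.\<close>
  have num: "(x * q - x' * inverse q) * (y - y') = (x - x') * (y * q - y' * inverse q)
    + (y * x' - x * y') * D" for x x' y y'
    by (simp add: D_def algebra_simps)
  show ?thesis
    using num[of "q powi a" "inverse (q powi a)" "q powi b" "inverse (q powi b)"] D q_neq_0
    by (simp add: br power_int_add power_int_diff divide_simps)
qed

lemma q_int_eq_q_br: "q_int n = q_br (int n)"
  by (simp add: q_int_def q_br_def power_int_minus power_inverse)

context quantum_affine_module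
begin

lemma torus_module: "torus_module scale T (\<lambda>n. q powi n)"
  by (intro torus_module.intro torus_module_axioms.intro vector_space_axioms linear_T inj_q_powi)

lemma weight_space_eq_wsp: "weight_space lam = torus_module.wsp scale T (\<lambda>n. q powi n) lam"
  by (simp add: weight_space_def torus_module.wsp_def[OF torus_module])

lemmas E_add = module_hom.add[OF Vector_Spaces.linear.axioms(3)[OF linear_E]]
lemmas F_add = module_hom.add[OF Vector_Spaces.linear.axioms(3)[OF linear_F]]
lemmas E_scale = module_hom.scale[OF Vector_Spaces.linear.axioms(3)[OF linear_E]]
lemmas F_scale = module_hom.scale[OF Vector_Spaces.linear.axioms(3)[OF linear_F]]

lemma E_weight_space:
  assumes "v \<in> weight_space lam"
  shows "E i v \<in> weight_space (lam + simple_root i)"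
  unfolding weight_space_def
proof (intro CollectI allI)
  fix h
  have "scale (q powi (- pairing lam h)) (T h (E i v)) = scale (q powi pairing (simple_root i) h) (E i v)"
    using T_E[of h i v] assms module_hom.scale[OF Vector_Spaces.linear.axioms(3)[OF linear_T]]
    by (simp add: weight_space_def pairing_uminus E_scale)
  then have "scale (q powi pairing lam h) (scale (q powi (- pairing lam h)) (T h (E i v)))
    = scale (q powi pairing lam h) (scale (q powi pairing (simple_root i) h) (E i v))" by simp
  then show "T h (E i v) = scale (q powi pairing (lam + simple_root i) h) (E i v)"
    using q_neq_0 by (simp add: pairing_add power_int_add power_int_minus)
qed

lemma F_weight_space:
  assumes "v \<in> weight_space lam"
  shows "F i v \<in> weight_space (lam - simple_root i)"
  unfolding weight_space_def
proof (intro CollectI allI)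
  fix h
  have "scale (q powi (- pairing lam h)) (T h (F i v)) = scale (q powi (- pairing (simple_root i) h)) (F i v)"
    using T_F[of h i v] assms module_hom.scale[OF Vector_Spaces.linear.axioms(3)[OF linear_T]]
    by (simp add: weight_space_def pairing_uminus F_scale)
  then have "scale (q powi pairing lam h) (scale (q powi (- pairing lam h)) (T h (F i v)))
    = scale (q powi pairing lam h) (scale (q powi (- pairing (simple_root i) h)) (F i v))" by simp
  then show "T h (F i v) = scale (q powi pairing (lam - simple_root i) h) (F i v)"
    using q_neq_0 by (simp add: pairing_diff power_int_diff power_int_minus divide_inverse)
qed

lemma q_fact_neq_0: "q_fact n \<noteq> 0"
  by (simp add: q_fact_def q_int_eq_q_br q_br_eq_0_iff)

lemma Serre_F_apply:
  assumes "i \<noteq> j"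
  shows "\<exists>a b c. \<forall>v. F i (F i (F i (F j v))) =
      scale a (F i (F i (F j (F i v)))) + scale b (F i (F j (F i (F i v)))) +
      scale c (F j (F i (F i (F i v))))"
proof -
  have N: "3 = nat (1 - pairing (simple_root j) (coroot i))"
    using assms hub_simple_root[of j i] by (simp add: hub_def)
  define c where "c k = (- 1) ^ k / (q_fact (3 - k) * q_fact k)" for k
  have c0: "c 0 \<noteq> 0" using q_fact_neq_0 by (simp add: c_def)
  have "F i (F i (F i (F j v))) =
      scale (- c 1 / c 0) (F i (F i (F j (F i v)))) + scale (- c 2 / c 0) (F i (F j (F i (F i v)))) +
      scale (- c 3 / c 0) (F j (F i (F i (F i v))))" for v
  proof -
    have "scale (c 0) (F i (F i (F i (F j v)))) + scale (c 1) (F i (F i (F j (F i v)))) +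
      scale (c 2) (F i (F j (F i (F i v)))) + scale (c 3) (F j (F i (F i (F i v)))) = 0"
      using Serre_F[OF assms N, of v] unfolding c_def
      by (simp add: numeral_3_eq_3 numeral_2_eq_2 atMost_Suc ac_simps)
    then have "scale (c 0) (F i (F i (F i (F j v)))) = scale (- c 1) (F i (F i (F j (F i v)))) +
      scale (- c 2) (F i (F j (F i (F i v)))) + scale (- c 3) (F j (F i (F i (F i v))))"
      by (simp add: algebra_simps eq_neg_iff_add_eq_0)
    then have "scale (1 / c 0) (scale (c 0) (F i (F i (F i (F j v))))) =
      scale (1 / c 0) (scale (- c 1) (F i (F i (F j (F i v)))) +
      scale (- c 2) (F i (F j (F i (F i v)))) + scale (- c 3) (F j (F i (F i (F i v)))))" by simp
    then show ?thesis using c0 by (simp add: scale_right_distrib scale_right_diff_distrib)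
  qed
  then show ?thesis by blast
qed

lemma hw_module:
  assumes irr: "irreducible_highest_weight Lam" and dom: "\<And>i. 0 \<le> hub Lam i"
  shows "hw_module scale T (\<lambda>n. q powi n) E F q_br Lam"
proof -
  interpret torus_module scale T "\<lambda>n. q powi n" by (rule torus_module)
  have ws: "weight_space = wsp" using weight_space_eq_wsp by blast
  show ?thesis
  proof
    fix i j lam v
    show "E i v \<in> wsp (lam + simple_root i)" if "v \<in> wsp lam"
      using that E_weight_space unfolding ws by blast
    show "F i v \<in> wsp (lam - simple_root i)" if "v \<in> wsp lam"
      using that F_weight_space unfolding ws by blast
    show "E i (F j v) = F j (E i v) + (if i = j then scale (q_br (hub lam i)) v else 0)"
      if "v \<in> wsp lam"
    proof -
      have "E i (F j v) - F j (E i v) = (if i = j then scale (q_br (hub lam i)) v else 0)"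
        unfolding E_F using that
        by (simp add: wsp_T pairing_uminus hub_def q_br_def flip: scale_left_diff_distrib)
      then show ?thesis by (metis add.commute diff_add_cancel)
    qed
    show "\<exists>a b c. \<forall>v. F i (F i (F i (F j v))) =
      scale a (F i (F i (F j (F i v)))) + scale b (F i (F j (F i (F i v)))) +
      scale c (F j (F i (F i (F i v))))" if "i \<noteq> j"
      using Serre_F_apply[OF that] .
    show "\<exists>v\<in>wsp Lam. v \<noteq> 0 \<and> (\<forall>i. E i v = 0)"
      using irr ws unfolding irreducible_highest_weight_def by metis
    show "W = {0} \<or> W = UNIV" if "subspace W" "\<And>w i. w \<in> W \<Longrightarrow> E i w \<in> W"
      "\<And>w i. w \<in> W \<Longrightarrow> F i w \<in> W" "\<And>w h. w \<in> W \<Longrightarrow> T h w \<in> W" for W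
      using irr that unfolding irreducible_highest_weight_def submodule_def by blast
  qed (simp_all add: E_add E_scale F_add F_scale dom q_br_eq_0_iff q_br_shift)
qed

end

context hw_module
begin

lemma wsp_eq_0:
  assumes "defect Lam lam < 0"
  shows "wsp lam = {0}"
  using defect_nonneg[of lam] assms unfolding weights_def by force

lemma lower_string_weights:
  assumes "int n \<le> hub Lam i"
  shows "Lam - int n \<odot> simple_root i \<in> weights"
proof -
  obtain v where "v \<in> wsp Lam" "v \<noteq> 0" "\<And>i. E i v = 0" using highest_weight by blast
  then show ?thesis using F_pow_singular_neq_0[OF _ _ _ assms] F_pow_wsp weightsI by blast
qed

end

section \<open>Crystal lattices and Kashiwara operators\<close>

lemma A_zero_add:
  assumes "x \<in> A_zero" "y \<in> A_zero"
  shows "x + y \<in> A_zero"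
proof -
  obtain f g f' g' where "x = Fract f g" "y = Fract f' g'" "poly g 0 \<noteq> 0" "poly g' 0 \<noteq> 0"
    using assms unfolding A_zero_def by blast
  moreover from this have "g \<noteq> 0" "g' \<noteq> 0" by auto
  ultimately have "x + y = Fract (f * g' + f' * g) (g * g')" "poly (g * g') 0 \<noteq> 0" by simp_all
  then show ?thesis unfolding A_zero_def by blast
qed

lemma zero_in_A_zero: "0 \<in> A_zero"
  unfolding A_zero_def Zero_fract_def by (intro CollectI exI[of _ 0] exI[of _ 1]) simp

context quantum_affine_module
begin

lemma crystal_latticeE:
  assumes "crystal_lattice L"
  obtains S where "L = {(\<Sum>x\<in>X. scale (c x) x) | X c. finite X \<and> X \<subseteq> S \<and> c ` X \<subseteq> A_zero}"
  using conjunct1[OF assms[unfolded crystal_lattice_def]] by (elim exE conjE) (rule that)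

lemma crystal_lattice_kashiwara:
  assumes "crystal_lattice L"
  shows "kashiwara_e i ` L \<subseteq> L" "kashiwara_f i ` L \<subseteq> L"
  using conjunct2[OF conjunct2[OF assms[unfolded crystal_lattice_def]]] by (simp_all add: image_subset_iff)

lemma crystal_lattice_add:
  assumes "crystal_lattice L" "v \<in> L" "w \<in> L"
  shows "v + w \<in> L"
proof -
  obtain S where L: "L = {(\<Sum>x\<in>X. scale (c x) x) | X c. finite X \<and> X \<subseteq> S \<and> c ` X \<subseteq> A_zero}"
    using assms(1) by (rule crystal_latticeE)
  obtain X c where X: "v = (\<Sum>x\<in>X. scale (c x) x)" "finite X" "X \<subseteq> S" "c ` X \<subseteq> A_zero"
    using assms(2) unfolding L by blast
  obtain Y e where Y: "w = (\<Sum>x\<in>Y. scale (e x) x)" "finite Y" "Y \<subseteq> S" "e ` Y \<subseteq> A_zero"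
    using assms(3) unfolding L by blast
  let ?c = "\<lambda>x. if x \<in> X then c x else 0" and ?e = "\<lambda>x. if x \<in> Y then e x else 0"
  have "v = (\<Sum>x\<in>X \<union> Y. scale (?c x) x)" "w = (\<Sum>x\<in>X \<union> Y. scale (?e x) x)"
    unfolding X(1) Y(1) by (rule sum.mono_neutral_cong_left; use X(2) Y(2) in auto)+
  then have "v + w = (\<Sum>x\<in>X \<union> Y. scale (?c x + ?e x) x)"
    by (simp only: scale_left_distrib sum.distrib)
  moreover have "?c x + ?e x \<in> A_zero" for x
    using X(4) Y(4) zero_in_A_zero by (intro A_zero_add) auto
  ultimately show ?thesis
    unfolding L using X(2,3) Y(2,3)
    by (intro CollectI exI[of _ "X \<union> Y"] exI[of _ "\<lambda>x. ?c x + ?e x"]) auto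
qed

lemma zero_in_crystal_lattice:
  assumes "crystal_lattice L"
  shows "0 \<in> L"
proof -
  obtain S where L: "L = {(\<Sum>x\<in>X. scale (c x) x) | X c. finite X \<and> X \<subseteq> S \<and> c ` X \<subseteq> A_zero}"
    using assms(1) by (rule crystal_latticeE)
  show ?thesis unfolding L by (intro CollectI exI[of _ "{}"]) auto
qed

text \<open>\<open>induced\<close> is a union over all representatives: \<open>v + q x\<close> goes
  to \<open>q (g x)\<close>, which stays in qL because \<open>g\<close> preserves \<open>L\<close>,
  and \<open>v\<close> itself contributes the whole zero coset.\<close>

lemma induced_coset_eq_0:
  assumes L: "crystal_lattice L" and g: "Vector_Spaces.linear scale scale g" "g ` L \<subseteq> L"
    and v: "g v = 0"
  shows "induced L g (coset L v) = coset L 0"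
proof
  have g_coset: "g (v + scale q x) = scale q (g x)" for x
    using g(1) v unfolding Vector_Spaces.linear_iff by simp
  show "induced L g (coset L v) \<subseteq> coset L 0"
  proof
    fix y assume "y \<in> induced L g (coset L v)"
    then obtain x z where "x \<in> L" "z \<in> L" "y = scale q (g x) + scale q z"
      unfolding induced_def coset_def by (auto simp: g_coset)
    then have "y = 0 + scale q (g x + z)" "g x + z \<in> L"
      using g(2) crystal_lattice_add[OF L] by (auto simp: scale_right_distrib)
    then show "y \<in> coset L 0" unfolding coset_def by blast
  qed
  have "v \<in> coset L v" unfolding coset_def using zero_in_crystal_lattice[OF L] by force
  then show "coset L 0 \<subseteq> induced L g (coset L v)" unfolding induced_def using v by force
qed

text \<open>A singular vector is its own string term with \<open>n = 0\<close>, so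
  \<open>kashiwara_e\<close> kills it. On each string term of \<open>v\<close>,
  \<open>kashiwara_f\<close> yields a vector of weight \<open>lam - simple_root i\<close>, which
  vanishes if that weight space does.\<close>

lemma
  assumes irr: "irreducible_highest_weight Lam" and dom: "\<And>i. 0 \<le> hub Lam i"
  shows linear_kashiwara_e: "Vector_Spaces.linear scale scale (kashiwara_e i)"
    and kashiwara_e_eq_0: "v \<in> weight_space lam \<Longrightarrow> E i v = 0 \<Longrightarrow> 0 \<le> hub lam i \<Longrightarrow> kashiwara_e i v = 0"
    and linear_kashiwara_f: "Vector_Spaces.linear scale scale (kashiwara_f i)"
    and kashiwara_f_eq_0: "v \<in> weight_space lam \<Longrightarrow> weight_space (lam - simple_root i) = {0} \<Longrightarrow>
      kashiwara_f i v = 0"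
proof -
  interpret hw: hw_module scale T "\<lambda>n. q powi n" E F q_br Lam by (rule hw_module[OF irr dom])
  have ws: "weight_space = hw.wsp" using weight_space_eq_wsp by blast
  have div: "F_divided = hw.F_div"
    by (intro ext) (simp add: F_divided_def hw.F_div_def hw.F_fact_def q_fact_def q_int_eq_q_br)
  \<comment> \<open>The case split at \<open>n = 0\<close> counters the truncated subtraction, which
    would fix singular vectors instead of killing them.\<close>
  have A: "Vector_Spaces.linear scale scale (\<lambda>u. if n = 0 then 0 else hw.F_div i (n - 1) u)" for n
    using hw.linear_F_div[of i "n - 1"] unfolding Vector_Spaces.linear_iff by simp
  have e: "Vector_Spaces.linear scale scale (kashiwara_e i) \<and>
     (\<forall>lam u n. u \<in> weight_space lam \<and> E i u = 0 \<and> int n \<le> pairing lam (coroot i) \<longrightarrow>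
        kashiwara_e i (F_divided i n u) = (if n = 0 then 0 else F_divided i (n - 1) u))"
    using theI'[OF hw.ex1_linear_on_strings[where i = i, OF A]]
    unfolding kashiwara_e_def ws div hub_def .
  have f: "Vector_Spaces.linear scale scale (kashiwara_f i) \<and>
     (\<forall>lam u n. u \<in> weight_space lam \<and> E i u = 0 \<and> int n \<le> pairing lam (coroot i) \<longrightarrow>
        kashiwara_f i (F_divided i n u) = F_divided i (n + 1) u)"
    using theI'[OF hw.ex1_linear_on_strings[where A = "\<lambda>n. hw.F_div i (n + 1)" and i = i, OF hw.linear_F_div]]
    unfolding kashiwara_f_def ws div hub_def .
  show lin_e: "Vector_Spaces.linear scale scale (kashiwara_e i)"
    and lin_f: "Vector_Spaces.linear scale scale (kashiwara_f i)" using e f by blast+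
  show "kashiwara_e i v = 0" if "v \<in> weight_space lam" "E i v = 0" "0 \<le> hub lam i"
  proof -
    have "kashiwara_e i (F_divided i 0 v) = 0"
      using e that unfolding hub_def by (metis of_nat_0)
    then show ?thesis unfolding div by simp
  qed
  show "kashiwara_f i v = 0" if v: "v \<in> weight_space lam" and zero: "weight_space (lam - simple_root i) = {0}"
  proof -
    have "v \<in> span (hw.strings i lam)" using v hw.wsp_eq_span_strings[of lam i] unfolding ws by blast
    then show ?thesis
    proof (induction rule: span_induct_alt)
      case base
      show ?case using lin_f unfolding Vector_Spaces.linear_iff_module_hom by (rule module_hom.zero)
    next
      case (step c x y)
      then obtain n u where u: "x = (F i ^^ n) u" "u \<in> hw.wsp (lam + int n \<odot> simple_root i)"
        "E i u = 0" "int n \<le> hub lam i + 2 * int n"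
        unfolding hw.strings_def by blast
      have "x = scale (q_fact n) (F_divided i n u)"
        using q_fact_neq_0 by (simp add: u(1) F_divided_def)
      moreover have "kashiwara_f i (F_divided i n u) = F_divided i (n + 1) u"
      proof -
        have "int n \<le> hub (lam + int n \<odot> simple_root i) i" using u(4) by simp
        then show ?thesis using f u(2,3) unfolding ws hub_def by blast
      qed
      moreover have "F_divided i (n + 1) u = 0"
      proof -
        have "lam + int n \<odot> simple_root i - int (Suc n) \<odot> simple_root i = lam - simple_root i"
          by (rule weight_eqI) (simp_all add: algebra_simps)
        then have "(F i ^^ Suc n) u \<in> weight_space (lam - simple_root i)"
          using hw.F_pow_wsp[OF u(2), of "Suc n" i] unfolding ws by metis
        then show ?thesis using zero by (simp add: F_divided_def)
      qed
      ultimately have "kashiwara_f i x = 0"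
        using lin_f unfolding Vector_Spaces.linear_iff by simp
      then show ?case using step lin_f unfolding Vector_Spaces.linear_iff by simp
    qed
  qed
qed

lemma defect_plus_simple_root:
  "defect Lam (lam + simple_root i) = defect Lam lam - of_int (hub lam i) - 1"
  "defect Lam (lam - simple_root i) = defect Lam lam + of_int (hub lam i) - 1"
  by (simp_all add: defect_def form_add_left form_add_right form_diff_left form_diff_right
      form_sym[of "simple_root i"] form_simple_root_hub field_simps)

lemma external_weightI:
  assumes irr: "irreducible_highest_weight Lam" and dom: "\<And>i. 0 \<le> hub Lam i"
    and cb: "crystal_base L B" and hub: "defect Lam eta \<le> of_int \<bar>hub eta i\<bar>"
  shows "external_weight L B i eta"
  unfolding external_weight_def external_element_def
proof (intro ballI impI conjI)
  interpret hw: hw_module scale T "\<lambda>n. q powi n" E F q_br Lam by (rule hw_module[OF irr dom])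
  have ws: "weight_space = hw.wsp" using weight_space_eq_wsp by blast
  have L: "crystal_lattice L" using cb[unfolded crystal_base_def] by (rule conjunct1)
  note stable = crystal_lattice_kashiwara[OF L]
  fix b assume "has_weight L b eta"
  then obtain v where v: "v \<in> weight_space eta" "b = coset L v" unfolding has_weight_def by blast
  show "induced L (kashiwara_e i) b = coset L 0" if "hub eta i > 0"
  proof -
    have "weight_space (eta + simple_root i) = {0}"
      unfolding ws using hub that by (intro hw.wsp_eq_0) (simp add: defect_plus_simple_root)
    then have "E i v = 0" using E_weight_space[OF v(1)] by blast
    then have "kashiwara_e i v = 0" using that by (intro kashiwara_e_eq_0[OF irr dom v(1)]) auto
    then show ?thesis
      unfolding v(2) by (rule induced_coset_eq_0[OF L linear_kashiwara_e[OF irr dom] stable(1)])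
  qed
  show "induced L (kashiwara_f i) b = coset L 0" if "hub eta i < 0"
  proof -
    have "weight_space (eta - simple_root i) = {0}"
      unfolding ws using hub that by (intro hw.wsp_eq_0) (simp add: defect_plus_simple_root)
    then have "kashiwara_f i v = 0" by (rule kashiwara_f_eq_0[OF irr dom v(1)])
    then show ?thesis
      unfolding v(2) by (rule induced_coset_eq_0[OF L linear_kashiwara_f[OF irr dom] stable(2)])
  qed
qed

end

section \<open>Maximal weights\<close>

context affine_module
begin

text \<open>The imaginary root vector [e_0, e_1], of weight delta; \<open>Y_delta\<close> is
  [f_1, f_0], of weight - delta.\<close>

definition X_delta :: "'v \<Rightarrow> 'v" where
  "X_delta v = E Node0 (E Node1 v) - E Node1 (E Node0 v)"

definition Y_delta :: "'v \<Rightarrow> 'v" where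
  "Y_delta v = F Node1 (F Node0 v) - F Node0 (F Node1 v)"

lemma E_diff: "E i (x - y) = E i x - E i y"
  by (rule module_hom.diff[OF Vector_Spaces.linear.axioms(3)[OF linear_E]])

lemma Y_delta_scale: "Y_delta (scale c v) = scale c (Y_delta v)"
  by (simp add: Y_delta_def F_scale scale_right_diff_distrib)

lemma X_delta_scale: "X_delta (scale c v) = scale c (X_delta v)"
  by (simp add: X_delta_def E_scale scale_right_diff_distrib)

text \<open>The sum of the two coroots is the canonical central element, which acts by the level; at
  positive level \<open>X_delta\<close> and \<open>Y_delta\<close> generate a Heisenberg
  algebra.\<close>

lemma heisenberg:
  "X_delta (Y_delta v) = Y_delta (X_delta v) + scale 2 (H (coroot Node0) v + H (coroot Node1) v)"
proof -
  have two: "scale 2 x = x + x" for x using scale_left_distrib[of 1 1 x] by simp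
  have H: "H (coroot i) (E j v) = E j (H (coroot i) v) + scale (of_int (hub (simple_root j) i)) (E j v)"
    "H (coroot i) (F j v) = F j (H (coroot i) v) - scale (of_int (hub (simple_root j) i)) (F j v)"
    for i j v using H_E_apply H_F_apply by (simp_all add: hub_def)
  show ?thesis
    unfolding X_delta_def Y_delta_def
    by (simp add: E_diff E_add F_diff F_add E_scale F_scale E_F_apply H two scale_right_diff_distrib
        scale_right_distrib del: coroot.simps simple_root.simps)
qed

text \<open>On a nonzero vector killed by \<open>Y_delta\<close>, the Heisenberg relation keeps all powers of \<open>X_delta\<close>
  nonzero, which is impossible because the weights are bounded above.\<close>

lemma minus_null_root_weights:
  assumes irr: "irreducible_highest_weight Lam" and dom: "\<And>i. 0 \<le> hub Lam i"
    and lam: "lam \<in> weights" "0 < hub lam Node0 + hub lam Node1"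
  shows "lam - null_root \<in> weights"
proof (rule ccontr)
  interpret hw: hw_module scale H of_int E F of_int Lam by (rule hw_module[OF irr dom])
  have ws: "weight_space = hw.wsp" using weight_space_eq_wsp by blast
  assume "lam - null_root \<notin> weights"
  then have zero: "hw.wsp (lam - null_root) = {0}" unfolding weights_def ws by blast
  obtain v where v: "v \<in> hw.wsp lam" "v \<noteq> 0"
    using lam(1) hw.weightsE[of lam] unfolding weights_def hw.weights_def ws by blast
  have X_wsp: "X_delta w \<in> hw.wsp (mu + null_root)" if "w \<in> hw.wsp mu" for w mu
  proof -
    have "E Node0 (E Node1 w) \<in> hw.wsp (mu + null_root)" "E Node1 (E Node0 w) \<in> hw.wsp (mu + null_root)"
      using hw.E_wsp[OF hw.E_wsp[OF that], of Node0 Node1] hw.E_wsp[OF hw.E_wsp[OF that], of Node1 Node0]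
      unfolding null_root_eq by (simp_all only: ac_simps)
    then show ?thesis unfolding X_delta_def by (rule subspace_diff[OF hw.subspace_wsp])
  qed
  have "F Node1 (F Node0 v) \<in> hw.wsp (lam - null_root)" "F Node0 (F Node1 v) \<in> hw.wsp (lam - null_root)"
    using hw.F_wsp[OF hw.F_wsp[OF v(1)], of Node0 Node1] hw.F_wsp[OF hw.F_wsp[OF v(1)], of Node1 Node0]
    unfolding null_root_eq by (simp_all only: diff_diff_eq ac_simps)
  then have Yv: "Y_delta v = 0" unfolding Y_delta_def using zero by simp
  define r where "r = hub lam Node0 + hub lam Node1"
  have X_pow: "(X_delta ^^ n) v \<in> hw.wsp (lam + int n \<odot> null_root)" for n
  proof (induction n)
    case (Suc n)
    have "lam + int (Suc n) \<odot> null_root = lam + int n \<odot> null_root + null_root"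
      by (rule weight_eqI) (simp_all add: algebra_simps)
    then show ?case using X_wsp[OF Suc.IH] by (simp only: funpow.simps comp_apply)
  qed (simp add: weight_scale_simps v)
  have X_Y: "X_delta (Y_delta ((X_delta ^^ n) v)) =
      Y_delta ((X_delta ^^ Suc n) v) + scale (of_int (2 * r)) ((X_delta ^^ n) v)" for n
  proof -
    have "H (coroot Node0) ((X_delta ^^ n) v) + H (coroot Node1) ((X_delta ^^ n) v)
      = scale (of_int r) ((X_delta ^^ n) v)"
      unfolding hw.wsp_T[OF X_pow] hub_def[symmetric]
      by (simp add: r_def scale_left_distrib del: coroot.simps)
    then show ?thesis unfolding heisenberg by simp
  qed
  have Y_X: "Y_delta ((X_delta ^^ Suc n) v) = scale (of_int (- 2 * (int n + 1) * r)) ((X_delta ^^ n) v)" for n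
  proof (induction n)
    case 0
    have "X_delta 0 = 0" using X_delta_scale[of 0 0] by simp
    then show ?case using X_Y[of 0] by (simp add: Yv eq_neg_iff_add_eq_0)
  next
    case (Suc n)
    have "Y_delta ((X_delta ^^ Suc (Suc n)) v) = scale (of_int (- 2 * (int n + 1) * r)) ((X_delta ^^ Suc n) v)
      - scale (of_int (2 * r)) ((X_delta ^^ Suc n) v)"
      using X_Y[of "Suc n"] unfolding Suc.IH by (simp add: X_delta_scale)
    also have "\<dots> = scale (of_int (- 2 * (int n + 1) * r) - of_int (2 * r)) ((X_delta ^^ Suc n) v)"
      by (simp only: scale_left_diff_distrib)
    also have "of_int (- 2 * (int n + 1) * r) - of_int (2 * r) = (of_int (- 2 * (int (Suc n) + 1) * r) :: complex)"
      by (simp add: algebra_simps)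
    finally show ?case .
  qed
  have nz: "(X_delta ^^ n) v \<noteq> 0" for n
  proof (induction n)
    case (Suc n)
    have "of_int (- 2 * (int n + 1) * r) \<noteq> (0 :: complex)"
      using lam(2) unfolding of_int_eq_0_iff r_def by simp
    then have "Y_delta ((X_delta ^^ Suc n) v) \<noteq> 0" unfolding Y_X using Suc by simp
    moreover have "Y_delta 0 = 0" using Y_delta_scale[of 0 0] by simp
    ultimately show ?case by metis
  qed (simp add: v)
  \<comment> \<open>One step more than the delta coordinate of \<open>Lam\<close> permits.\<close>
  define n where "n = nat (snd (snd Lam) - snd (snd lam)) + 1"
  have "lam + int n \<odot> null_root \<in> below Lam"
    using hw.weights_below_Lam[OF hw.weightsI[OF X_pow nz]] .
  then show False unfolding below_iff by (auto simp: n_def null_root_def split: if_splits)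
qed

text \<open>The reflections act on column indices by \<open>m\<close> to \<open>a1 - m\<close> and
  \<open>m\<close> to \<open>- a0 - m\<close>, so their composites translate by
  \<open>\<plusminus> (a0 + a1)\<close>. The strings through \<open>Lam\<close> cover the columns
  from \<open>- a0\<close> to \<open>a1\<close>, a full set of residues.\<close>

lemma column_nonempty:
  assumes irr: "irreducible_highest_weight Lam" and dom: "\<And>i. 0 \<le> hub Lam i"
    and level: "0 < hub Lam Node0 + hub Lam Node1"
  shows "\<exists>k. Lam - m \<odot> simple_root Node1 - k \<odot> null_root \<in> weights"
proof -
  interpret hw: hw_module scale H of_int E F of_int Lam by (rule hw_module[OF irr dom])
  have weights: "weights = hw.weights" unfolding weights_def hw.weights_def weight_space_eq_wsp ..
  define a0 a1 where "a0 = hub Lam Node0" and "a1 = hub Lam Node1"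
  define C where "C = {m. \<exists>k. Lam - m \<odot> simple_root Node1 - k \<odot> null_root \<in> weights}"
  have refl1: "a1 - m \<in> C" if m: "m \<in> C" for m
  proof -
    obtain k where "Lam - m \<odot> simple_root Node1 - k \<odot> null_root \<in> weights" using m C_def by blast
    from hw.reflection_weights[OF this[unfolded weights], of Node1]
    have "Lam - m \<odot> simple_root Node1 - k \<odot> null_root - (a1 - 2 * m) \<odot> simple_root Node1 \<in> weights"
      by (simp only: weights hub_diff hub_scale hub_simple_root hub_null_root a1_def) (simp add: mult.commute)
    moreover have "Lam - m \<odot> simple_root Node1 - k \<odot> null_root - (a1 - 2 * m) \<odot> simple_root Node1
      = Lam - (a1 - m) \<odot> simple_root Node1 - k \<odot> null_root"
      by (rule weight_eqI) (simp_all add: algebra_simps)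
    ultimately show ?thesis unfolding C_def mem_Collect_eq by metis
  qed
  have refl0: "- a0 - m \<in> C" if m: "m \<in> C" for m
  proof -
    obtain k where "Lam - m \<odot> simple_root Node1 - k \<odot> null_root \<in> weights" using m C_def by blast
    from hw.reflection_weights[OF this[unfolded weights], of Node0]
    have "Lam - m \<odot> simple_root Node1 - k \<odot> null_root - (a0 + 2 * m) \<odot> simple_root Node0 \<in> weights"
      by (simp only: weights hub_diff hub_scale hub_simple_root hub_null_root a0_def) (simp add: mult.commute)
    moreover have "Lam - m \<odot> simple_root Node1 - k \<odot> null_root - (a0 + 2 * m) \<odot> simple_root Node0
      = Lam - (- a0 - m) \<odot> simple_root Node1 - (k + a0 + 2 * m) \<odot> null_root"
      by (rule weight_eqI) (simp_all add: algebra_simps null_root_def)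
    ultimately show ?thesis unfolding C_def mem_Collect_eq by metis
  qed
  have base: "m \<in> C" if "- a0 \<le> m" "m \<le> a1" for m
  proof (cases "0 \<le> m")
    case True
    then have "Lam - m \<odot> simple_root Node1 - 0 \<odot> null_root \<in> weights"
      using hw.lower_string_weights[of "nat m" Node1] that(2) weights a1_def
      by (simp add: weight_scale_simps)
    then show ?thesis unfolding C_def by blast
  next
    case False
    then have "Lam - (- m) \<odot> simple_root Node0 \<in> weights"
      using hw.lower_string_weights[of "nat (- m)" Node0] that(1) weights a0_def by simp
    moreover have "Lam - (- m) \<odot> simple_root Node0 = Lam - m \<odot> simple_root Node1 - (- m) \<odot> null_root"
      by (rule weight_eqI) (simp_all add: algebra_simps null_root_def)
    ultimately show ?thesis unfolding C_def mem_Collect_eq by metis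
  qed
  \<comment> \<open>The representative of \<open>m\<close> modulo \<open>a0 + a1\<close> that lies
    between \<open>- a0\<close> and \<open>a1 - 1\<close>.\<close>
  define u where "u = (m + a0) mod (a0 + a1) - a0"
  have r: "0 < a0 + a1" using level by (simp add: a0_def a1_def)
  have u: "u \<in> C"
    using base[of u] pos_mod_bound[OF r, of "m + a0"] pos_mod_sign[OF r, of "m + a0"] by (simp add: u_def)
  have "u + c * (a0 + a1) \<in> C" for c
  proof (induction c rule: int_induct[where k = 0])
    case base then show ?case using u by simp
  next
    case (step1 c)
    have "a1 - (- a0 - (u + c * (a0 + a1))) = u + (c + 1) * (a0 + a1)" by (simp add: algebra_simps)
    then show ?case using refl1[OF refl0[OF step1(2)]] by metis
  next
    case (step2 c)
    have "- a0 - (a1 - (u + c * (a0 + a1))) = u + (c - 1) * (a0 + a1)" by (simp add: algebra_simps)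
    then show ?case using refl0[OF refl1[OF step2(2)]] by metis
  qed
  moreover have "m = u + ((m + a0) div (a0 + a1)) * (a0 + a1)"
    using div_mult_mod_eq[of "m + a0" "a0 + a1"] unfolding u_def by linarith
  ultimately have "m \<in> C" by metis
  then show ?thesis unfolding C_def by blast
qed

text \<open>In a column the admissible \<open>k\<close> are nonnegative, nonempty and closed under
  successor, hence a ray; its least element gives the only maximal weight, so the description in
  \<open>s_fun\<close> denotes.\<close>

lemma s_fun_weights:
  assumes irr: "irreducible_highest_weight Lam" and dom: "\<And>i. 0 \<le> hub Lam i"
    and level: "0 < hub Lam Node0 + hub Lam Node1"
  shows "Lam - m \<odot> simple_root Node1 - s_fun weights Lam m \<odot> null_root \<in> weights"
proof -
  interpret hw: hw_module scale H of_int E F of_int Lam by (rule hw_module[OF irr dom])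
  have weights: "weights = hw.weights" unfolding weights_def hw.weights_def weight_space_eq_wsp ..
  define wt where "wt k = Lam - m \<odot> simple_root Node1 - k \<odot> null_root" for k
  have shift: "wt k + null_root = wt (k - 1)" "wt k - null_root = wt (k + 1)" for k
    unfolding wt_def by (rule weight_eqI; simp add: algebra_simps)+
  have up: "wt (k + int n) \<in> weights" if "wt k \<in> weights" for k n
  proof (induction n)
    case (Suc n)
    have "0 < hub (wt (k + int n)) Node0 + hub (wt (k + int n)) Node1"
      using level by (simp add: wt_def del: simple_root.simps)
    from minus_null_root_weights[OF irr dom Suc this] show ?case by (simp add: shift ac_simps)
  qed (simp add: that)
  have nonneg: "0 \<le> k" if "wt k \<in> weights" for k
    using hw.weights_below_Lam[OF that[unfolded weights]] unfolding below_iff wt_def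
    by (auto simp: null_root_def)
  obtain k where k: "wt k \<in> weights" using column_nonempty[OF irr dom level, of m] wt_def by auto
  define N where "N = (LEAST n. wt (int n) \<in> weights)"
  have "wt (int (nat k)) \<in> weights" using k nonneg by simp
  then have N: "wt (int N) \<in> weights" unfolding N_def by (rule LeastI)
  have "wt (int N - 1) \<notin> weights"
  proof
    assume *: "wt (int N - 1) \<in> weights"
    then have "wt (int (N - 1)) \<in> weights" "1 \<le> N" using nonneg[OF *] by (simp_all add: of_nat_diff)
    then have "N \<le> N - 1" unfolding N_def by (intro Least_le) simp
    then show False using \<open>1 \<le> N\<close> by simp
  qed
  then have max: "wt (int N) \<in> maximal_weights weights" using N by (simp add: maximal_weights_def shift)
  have "j = int N" if "wt j \<in> maximal_weights weights" for j
  proof -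
    have j: "wt j \<in> weights" "wt (j - 1) \<notin> weights" using that by (auto simp: maximal_weights_def shift)
    have "N \<le> nat j" unfolding N_def using j(1) nonneg by (intro Least_le) simp
    moreover have "\<not> N \<le> nat (j - 1)" if "0 < j"
      using up[OF N, of "nat (j - 1) - N"] j(2) that by (auto simp: of_nat_diff)
    ultimately show ?thesis using nonneg[OF j(1)] by (cases "0 < j") auto
  qed
  with max have "s_fun weights Lam m = int N" unfolding s_fun_def wt_def by (intro the_equality)
  then show ?thesis using N by (simp add: wt_def)
qed

end


section \<open>Degrees of weights of fixed defect\<close>

text \<open>Multiplied by \<open>r\<close>, the degree of a weight of fixed defect is a convex quadratic function of \<open>m\<close>.
  With \<open>p = m1 - m\<close> and \<open>n = m - m0\<close>, the two degree bounds become upper bounds for \<open>p n\<close>. They leave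
  only the case \<open>r = 2\<close> with \<open>p = 1\<close> or \<open>n = 1\<close>, which is excluded by parity.\<close>

lemma degree_bound_imp_outer:
  fixes a0 a1 d m k m0 m1 s0 s1 :: int
  assumes r: "2 \<le> a0 + a1"
    and d: "m * (a1 - m) + k * (a0 + a1) = d"
    and s1: "0 \<le> m1 * (a1 - m1) + s1 * (a0 + a1)"
    and s0: "0 \<le> m0 * (a1 - m0) + s0 * (a0 + a1)"
    and m1: "d + a1 \<le> 2 * m1" "2 * m1 \<le> d + a1 + 1"
    and m0: "d + a0 \<le> - 2 * m0" "- 2 * m0 \<le> d + a0 + 1"
    and deg: "2 * s1 + m1 \<le> 2 * k + m" "2 * s0 + m0 \<le> 2 * k + m"
  shows "m1 \<le> m \<or> m \<le> m0"
proof (rule ccontr)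
  assume outer: "\<not> (m1 \<le> m \<or> m \<le> m0)"
  define p n where "p = m1 - m" and "n = m - m0"
  have pn: "1 \<le> p" "1 \<le> n" using outer by (simp_all add: p_def n_def)
  \<comment> \<open>The rounding errors of the two ceilings; \<open>D1\<close> and \<open>D0\<close>
    below are the defects in columns \<open>m1\<close> and \<open>m0\<close>.\<close>
  define e1 e0 where "e1 = 2 * m1 - d - a1" and "e0 = - 2 * m0 - d - a0"
  define D1 D0 where "D1 = m1 * (a1 - m1) + s1 * (a0 + a1)" and "D0 = m0 * (a1 - m0) + s0 * (a0 + a1)"
  have e: "e1 = 0 \<or> e1 = 1" "e0 = 0 \<or> e0 = 1" using m1 m0 by (auto simp: e1_def e0_def)
  have level: "2 * d + (a0 + a1) = 2 * p + 2 * n - e0 - e1"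
    by (simp add: p_def n_def e1_def e0_def)
  have "(2 * s1 + m1) * (a0 + a1) \<le> (2 * k + m) * (a0 + a1)"
    "(2 * s0 + m0) * (a0 + a1) \<le> (2 * k + m) * (a0 + a1)"
    using deg r by (intro mult_right_mono; simp)+
  moreover have "(2 * k + m) * (a0 + a1) - (2 * s1 + m1) * (a0 + a1)
      = 2 * d - 2 * D1 - p * (2 * n + e1 - e0)"
  proof -
    have E: "2 * n + e1 - e0 = 2 * (m1 + m) - 2 * a1 + (a0 + a1)" by (simp add: n_def e1_def e0_def)
    show ?thesis unfolding E D1_def d[symmetric] p_def by (simp add: algebra_simps)
  qed
  moreover have "(2 * k + m) * (a0 + a1) - (2 * s0 + m0) * (a0 + a1)
      = 2 * d - 2 * D0 - n * (2 * p + e0 - e1)"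
  proof -
    have E: "2 * p + e0 - e1 = - 2 * (m + m0) + 2 * a1 - (a0 + a1)" by (simp add: p_def e1_def e0_def)
    show ?thesis unfolding E D0_def d[symmetric] n_def by (simp add: algebra_simps)
  qed
  ultimately have A: "p * (2 * n + e1 - e0) + 2 * D1 \<le> 2 * d" and B: "n * (2 * p + e0 - e1) + 2 * D0 \<le> 2 * d"
    by linarith+
  have D: "0 \<le> D1" "0 \<le> D0" using s1 s0 by (simp_all add: D1_def D0_def)
  have prod: "0 \<le> (p - 1) * (n - 1)" using pn by simp
  \<comment> \<open>Unequal rounding adds \<open>p\<close> or \<open>n\<close> to one product bound,
    while \<open>level\<close> caps \<open>2 * d\<close> at \<open>2 * p + 2 * n - 3\<close>, below
    \<open>2 * (p * n)\<close>.\<close>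
  have neq: False if "e1 \<noteq> e0"
  proof -
    have "2 * (p * n) + p \<le> 2 * d \<or> 2 * (p * n) + n \<le> 2 * d"
      using A B D that e by (auto simp: algebra_simps)
    moreover have "2 * d \<le> 2 * p + 2 * n - 3" using level r that e by auto
    moreover have "p + n \<le> p * n + 1" using prod by (simp add: algebra_simps)
    ultimately show False using pn by linarith
  qed
  then have e_eq: "e1 = e0" by blast
  then have "2 * (p * n) + 2 * D1 \<le> 2 * d" "2 * (p * n) + 2 * D0 \<le> 2 * d"
    using A B by (simp_all add: algebra_simps)
  moreover have "p * n = p + n - 1 + (p - 1) * (n - 1)" by (simp add: algebra_simps)
  moreover have "0 \<le> e0" using e(2) by auto
  \<comment> \<open>Together the bounds say that \<open>a0 + a1 - 2\<close>, \<open>2 * e0\<close>,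
    \<open>2 * (p - 1) * (n - 1)\<close> and either \<open>2 * D1\<close> or \<open>2 * D0\<close>
    have sum at most 0; each is nonnegative.\<close>
  ultimately have eqs: "a0 + a1 = 2" "e0 = 0" "D1 = 0" "D0 = 0" "(p - 1) * (n - 1) = 0"
    using level e_eq r D prod by linarith+
  have par: "even (d + a1)" using eqs(2) e_eq unfolding e1_def by presburger
  from eqs(5) consider "m = m1 - 1" | "m = m0 + 1" by (auto simp: p_def n_def)
  then show False
  proof cases
    case 1
    have "d - D1 = 2 * (k - s1) + 2 * m1 - a1 - 1"
      unfolding D1_def d[symmetric] eqs(1) 1 by (simp add: algebra_simps)
    then show False using par eqs(3) by presburger
  next
    case 2
    have "d - D0 = 2 * (k - s0) - 2 * m0 + a1 - 1"
      unfolding D0_def d[symmetric] eqs(1) 2 by (simp add: algebra_simps)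
    then show False using par eqs(4) by presburger
  qed
qed

lemma defect_column:
  assumes "Lam = a0 \<odot> fund Node0 + a1 \<odot> fund Node1"
  shows "defect Lam (Lam - m \<odot> simple_root Node1 - k \<odot> null_root)
    = of_int (m * (a1 - m) + k * (a0 + a1))"
  unfolding assms defect_def by (simp add: null_root_def field_simps)

lemma degree_below_eq:
  fixes c0 c1 :: nat
  shows "degree_below Lam (Lam - (int c0 \<odot> simple_root Node0 + int c1 \<odot> simple_root Node1)) = int c0 + int c1"
  unfolding degree_below_def
proof (rule the_equality)
  fix n
  assume "\<exists>d0 d1 :: nat. Lam - (int c0 \<odot> simple_root Node0 + int c1 \<odot> simple_root Node1)
      = Lam - (int d0 \<odot> simple_root Node0 + int d1 \<odot> simple_root Node1) \<and> n = int d0 + int d1"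
  then show "n = int c0 + int c1" by (auto simp: prod_eq_iff null_root_def)
qed blast

lemma ceiling_half:
  fixes x :: int
  shows "x \<le> 2 * \<lceil>of_int x / 2 :: rat\<rceil>" "2 * \<lceil>of_int x / 2 :: rat\<rceil> \<le> x + 1"
proof -
  define c where "c = \<lceil>of_int x / 2 :: rat\<rceil>"
  have "(of_int x / 2 :: rat) \<le> of_int c" "of_int c < (of_int x / 2 :: rat) + 1"
    using ceiling_correct[of "of_int x / 2 :: rat"] unfolding c_def by linarith+
  then have "(of_int x :: rat) \<le> of_int (2 * c)" "(of_int (2 * c) :: rat) < of_int (x + 2)"
    by simp_all
  then show "x \<le> 2 * \<lceil>of_int x / 2 :: rat\<rceil>" "2 * \<lceil>of_int x / 2 :: rat\<rceil> \<le> x + 1"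
    unfolding of_int_le_iff of_int_less_iff c_def by linarith+
qed

theorem proposition4p1:
  fixes a0 a1 d :: nat and Lam eta :: weight and P :: "weight set"
    and scaleV :: "complex \<Rightarrow> 'v::ab_group_add \<Rightarrow> 'v"
    and EV FV :: "node \<Rightarrow> 'v \<Rightarrow> 'v" and HV :: "coweight \<Rightarrow> 'v \<Rightarrow> 'v"
    and scaleM :: "qfield \<Rightarrow> 'm::ab_group_add \<Rightarrow> 'm"
    and EM FM :: "node \<Rightarrow> 'm \<Rightarrow> 'm" and TM :: "coweight \<Rightarrow> 'm \<Rightarrow> 'm"
    and L :: "'m set" and B :: "'m set set"
  assumes "a0 + a1 > 1"
    and "Lam = int a0 \<odot> fund Node0 + int a1 \<odot> fund Node1"
    and "affine_module scaleV EV FV HV"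
    and "affine_module.irreducible_highest_weight scaleV EV FV HV Lam"
    and "P = affine_module.weights scaleV HV"
    and "quantum_affine_module scaleM EM FM TM"
    and "quantum_affine_module.irreducible_highest_weight scaleM EM FM TM Lam"
    and "quantum_affine_module.crystal_base scaleM EM FM TM L B"
    and "d > 0"
    and "eta \<in> P"
    and "defect Lam eta = of_nat d"
    and "degree_below Lam eta \<ge> N_prime P a0 a1 d"
  shows "\<forall>i. quantum_affine_module.external_weight scaleM EM FM TM L B i eta"
proof
  fix i
  interpret V: affine_module scaleV EV FV HV by (rule assms(3))
  interpret M: quantum_affine_module scaleM EM FM TM by (rule assms(6))
  have hubs: "hub Lam Node0 = int a0" "hub Lam Node1 = int a1"
    unfolding assms(2) by (simp_all add: hub_def)
  have dom: "0 \<le> hub Lam j" for j by (cases j) (simp_all add: hubs)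
  interpret W: hw_module scaleV HV of_int EV FV of_int Lam
    by (rule V.hw_module[OF assms(4) dom])
  have P: "P = V.weights" "P = W.weights"
    unfolding assms(5) V.weights_def W.weights_def V.weight_space_eq_wsp by simp_all
  define wt where "wt m k = Lam - m \<odot> simple_root Node1 - k \<odot> null_root" for m k
  have max_defect: "0 \<le> m * (int a1 - m) + s_fun P Lam m * (int a0 + int a1)" for m
  proof -
    have "wt m (s_fun P Lam m) \<in> W.weights"
      using V.s_fun_weights[OF assms(4) dom, of m] assms(1) P unfolding wt_def hubs by simp
    from W.defect_nonneg[OF this] show ?thesis
      unfolding wt_def defect_column[OF assms(2)] of_int_0_le_iff .
  qed
  obtain c0 c1 :: nat
    where eta: "eta = Lam - (int c0 \<odot> simple_root Node0 + int c1 \<odot> simple_root Node1)"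
    using W.weights_below_Lam assms(10) P(2) unfolding below_def by blast
  \<comment> \<open>c0 alpha_0 + c1 alpha_1 equals c0 delta + (c1 - c0) alpha_1, so the degree is
    \<open>2 * int c0 + m\<close>.\<close>
  define m where "m = int c1 - int c0"
  have eta_wt: "eta = wt m (int c0)"
    unfolding eta wt_def m_def by (rule weight_eqI) (simp_all add: null_root_def algebra_simps)
  have "of_int (m * (int a1 - m) + int c0 * (int a0 + int a1)) = (of_int (int d) :: rat)"
    using assms(11) unfolding eta_wt wt_def defect_column[OF assms(2)] by simp
  then have d: "m * (int a1 - m) + int c0 * (int a0 + int a1) = int d"
    unfolding of_int_eq_iff .
  have deg: "max (2 * s_fun P Lam (m_zero a0 d) + m_zero a0 d) (2 * s_fun P Lam (m_one a1 d) + m_one a1 d)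
      \<le> 2 * int c0 + m"
    using assms(12) unfolding eta degree_below_eq N_prime_def assms(2)[symmetric] Let_def m_def by simp
  have m_one: "int d + int a1 \<le> 2 * m_one a1 d" "2 * m_one a1 d \<le> int d + int a1 + 1"
    using ceiling_half[of "int d + int a1"] by (simp_all add: m_one_def)
  have m_zero: "int d + int a0 \<le> - 2 * m_zero a0 d" "- 2 * m_zero a0 d \<le> int d + int a0 + 1"
    using ceiling_half[of "int d + int a0"] by (simp_all add: m_zero_def)
  have "m_one a1 d \<le> m \<or> m \<le> m_zero a0 d"
    by (rule degree_bound_imp_outer[OF _ d max_defect max_defect m_one m_zero]) (use assms(1) deg in auto)
  \<comment> \<open>The hubs sum to \<open>a0 + a1\<close>, so once one is at most
    \<open>- d\<close> the other is at least \<open>d\<close>.\<close>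
  then have "int d \<le> \<bar>int a0 + 2 * m\<bar> \<and> int d \<le> \<bar>int a1 - 2 * m\<bar>"
    using m_one(1) m_zero(1) by linarith
  moreover have "hub eta Node0 = int a0 + 2 * m" "hub eta Node1 = int a1 - 2 * m"
    unfolding eta_wt wt_def by (simp_all add: hubs del: simple_root.simps)
  ultimately have "int d \<le> \<bar>hub eta i\<bar>" by (cases i) simp_all
  then have "defect Lam eta \<le> of_int \<bar>hub eta i\<bar>"
    unfolding assms(11) by (metis of_int_le_iff of_int_of_nat_eq)
  then show "M.external_weight L B i eta"
    by (rule M.external_weightI[OF assms(7) dom assms(8)])
qed

end
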